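(* Let $\gamma_1=(m_1,N_1,a_1)$, $\gamma_2=(m_2,N_2,a_2)$ be an admissible pair of (generalized) monodromy data, let $m_3={\rm lcm}(m_1,m_2)$, $d_i=m_3/m_i$, and let $p$ be a prime with $p\nmid m_3$. Let $\gamma_3$ be the (generalized) monodromy datum obtained by clutching $\gamma_1$ and $\gamma_2$, and let $u_i$ be the $\mu$-ordinary Newton polygon of $\gamma_i$ at $p$, $i=1,2,3$. Let $r_0=\gcd(m_1,a_1(N_1),m_2,a_2(1))$ and $\epsilon=d_1d_2r_0-d_1-d_2+1$. Then the equality $$u_3=u_1^{d_1}\oplus u_2^{d_2}\oplus{\rm ord}^\epsilon$$ holds if and only if the pair $\gamma_1,\gamma_2$ is balanced.
   Context: Newton polygons are multi-sets of slopes; $\oplus$ is disjoint union of multi-sets, $\nu^d$ the sum of $d$ copies, ${\rm ord}=\{0,1\}$. A monodromy datum is $\gamma=(m,N,a)$ with $m\ge2$, $N\ge3$, $a=(a(1),\dots,a(N))\in\mathbb{Z}^N$, such that $a(i)\not\equiv0\bmod m$ for all $i$, $\gcd(m,a(1),\dots,a(N))=1$, $\sum_ia(i)\equiv0\bmod m$. In a generalized monodromy datum, entries $a(i)\equiv0\bmod m$ are allowed (then $\gcd(a(i),m)=m$). Signature and $\mu$-ordinary polygon. The signature of $\gamma$ is $\mathfrak{f}(\tau_n)=-1+\sum_i\langle -na(i)/m\rangle$ for $0\neq n\in\mathbb{Z}/m\mathbb{Z}$, $\mathfrak{f}(\tau_0)=0$, with $\langle\cdot\rangle$ the fractional part. The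 $\mu$-ordinary Newton polygon $u$ at $p\nmid m$ is the lowest Newton polygon (unique maximal element of the Kottwitz set) of the PEL-type Shimura variety attached to $\mu_m$ and $\mathfrak{f}$. Explicitly: put $g(\tau_n)=\mathfrak{f}(\tau_n)+\mathfrak{f}(\tau_{-n})$, constant (denoted $g(\mathfrak{o})$) on each orbit $\mathfrak{o}$ of multiplication by $p$ on $\mathbb{Z}/m\mathbb{Z}-\{0\}$; let $g(\mathfrak{o})>E(1)>\dots>E(s)>0$ be the distinct values of $\mathfrak{f}$ on $\mathfrak{o}$ in $[1,g(\mathfrak{o})-1]$, $E(0)=g(\mathfrak{o})$, $E(s+1)=0$. Then $u=\bigoplus_{\mathfrak{o}}u(\mathfrak{o})$, where $u(\mathfrak{o})$ has slopes $\lambda(t)=\frac1{|\mathfrak{o}|}\#\{\tau\in\mathfrak{o}\mid\mathfrak{f}(\tau)\ge E(t)\}$ with multiplicity $|\mathfrak{o}|(E(t)-E(t+1))$, $0\le t\le s$. Pairs. The pair is admissible (hypothesis (A)) if $d_1a_1(N_1)+d_2a_2(1)\equiv0\bmod m_3$. Then $\gamma_3=(m_3,N_1+N_2-2,a_3)$ with $a_3(i)=d_1a_1(i)$ for $1\le i\le N_1-1$ and $a_3(i)=d_2a_2(i-N_1+2)$ for $N_1\le i\le N_1+N_2-2$. Let $\mathfrak{f}_i^\dagger=\mathfrak{f}_i\circ\pi_i$, where $\pi_i:\mathbb{Z}/m_3\mathbb{Z}\to\mathbb{Z}/m_i\mathbb{Z}$ is the projection. The pair is balanced (hypothesis (B))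 if for each orbit $\mathfrak{o}$ of multiplication by $p$ on $\mathbb{Z}/m_3\mathbb{Z}$ and all $\omega,\tau\in\mathfrak{o}$: if $\mathfrak{f}_1^\dagger(\omega)>\mathfrak{f}_1^\dagger(\tau)$ then $\mathfrak{f}_2^\dagger(\omega)\ge\mathfrak{f}_2^\dagger(\tau)$; and if $\mathfrak{f}_2^\dagger(\omega)>\mathfrak{f}_2^\dagger(\tau)$ then $\mathfrak{f}_1^\dagger(\omega)\ge\mathfrak{f}_1^\dagger(\tau)$. *)

theory Defs
  imports Complex_Main "HOL-Library.Multiset" "HOL-Number_Theory.Cong" "HOL-Computational_Algebra.Primes"
begin

text \<open>A triple (m, N, a). The entries a(1), ..., a(N) are the values of
  \<open>entry\<close> on \<open>{1..N}\<close>; its other values are irrelevant.\<close>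

record monodromy_datum =
  modulus :: nat
  npoints :: nat
  entry :: "nat \<Rightarrow> int"

text \<open>Entries divisible by m are allowed, so ordinary monodromy data are included.\<close>

definition generalized_monodromy_datum :: "monodromy_datum \<Rightarrow> bool" where
  "generalized_monodromy_datum \<gamma> \<longleftrightarrow>
     modulus \<gamma> \<ge> 2 \<and> npoints \<gamma> \<ge> 3 \<and>
     Gcd (insert (int (modulus \<gamma>)) (entry \<gamma> ` {1..npoints \<gamma>})) = 1 \<and>
     [(\<Sum>i=1..npoints \<gamma>. entry \<gamma> i) = 0] (mod int (modulus \<gamma>))"

text \<open>\<open>signature \<gamma> n\<close> is f(\<tau>_n), where the integer n stands for its class modulo m.
  The values are integers because the entries sum to 0 modulo m.\<close>

definition signature :: "monodromy_datum \<Rightarrow> int \<Rightarrow> rat" where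
  "signature \<gamma> n =
     (if int (modulus \<gamma>) dvd n then 0
      else - 1 + (\<Sum>i=1..npoints \<gamma>. frac (of_int (- n * entry \<gamma> i) / of_nat (modulus \<gamma>))))"

text \<open>Z/mZ is represented by the residues \<open>{0..<m}\<close>.\<close>

definition mult_orbit :: "nat \<Rightarrow> nat \<Rightarrow> int \<Rightarrow> int set" where
  "mult_orbit p m n = range (\<lambda>k. (int p ^ k * n) mod int m)"

definition orbit_g :: "monodromy_datum \<Rightarrow> int set \<Rightarrow> rat" where
  "orbit_g \<gamma> \<oo> = (THE c. \<forall>n\<in>\<oo>. signature \<gamma> n + signature \<gamma> (- n) = c)"

text \<open>The list E(0), E(1), ..., E(s), E(s+1).\<close>

definition orbit_E :: "monodromy_datum \<Rightarrow> int set \<Rightarrow> rat list" where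
  "orbit_E \<gamma> \<oo> =
     orbit_g \<gamma> \<oo> #
     rev (sorted_list_of_set {v \<in> signature \<gamma> ` \<oo>. 1 \<le> v \<and> v \<le> orbit_g \<gamma> \<oo> - 1}) @ [0]"

definition orbit_slope :: "monodromy_datum \<Rightarrow> int set \<Rightarrow> nat \<Rightarrow> rat" where
  "orbit_slope \<gamma> \<oo> t =
     of_nat (card {n \<in> \<oo>. orbit_E \<gamma> \<oo> ! t \<le> signature \<gamma> n}) / of_nat (card \<oo>)"

text \<open>The entries of \<open>orbit_E\<close> are integers in decreasing order, so \<open>nat \<lfloor>_\<rfloor>\<close> is only a
  change of type. The index t runs through 0, ..., s, where s + 2 is the length of the list.\<close>

definition orbit_polygon :: "monodromy_datum \<Rightarrow> int set \<Rightarrow> rat multiset" where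
  "orbit_polygon \<gamma> \<oo> =
     (\<Sum>t<length (orbit_E \<gamma> \<oo>) - 1.
        replicate_mset
          (nat \<lfloor>of_nat (card \<oo>) * (orbit_E \<gamma> \<oo> ! t - orbit_E \<gamma> \<oo> ! (t + 1))\<rfloor>)
          (orbit_slope \<gamma> \<oo> t))"

text \<open>The \<mu>-ordinary Newton polygon at a prime p not dividing m, as a multiset of slopes, given
  by its explicit formula as a sum over the orbits of multiplication by p on Z/mZ - {0}.\<close>

definition mu_ordinary :: "nat \<Rightarrow> monodromy_datum \<Rightarrow> rat multiset" where
  "mu_ordinary p \<gamma> =
     (\<Sum>\<oo>\<in>mult_orbit p (modulus \<gamma>) ` {1..<int (modulus \<gamma>)}. orbit_polygon \<gamma> \<oo>)"

definition ord_polygon :: "rat multiset" where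
  "ord_polygon = {#0, 1#}"

definition lcm_modulus :: "monodromy_datum \<Rightarrow> monodromy_datum \<Rightarrow> nat" where
  "lcm_modulus \<gamma>1 \<gamma>2 = lcm (modulus \<gamma>1) (modulus \<gamma>2)"

text \<open>\<open>rel_degree \<gamma>1 \<gamma>2 \<gamma>\<close> is m3/m for \<open>\<gamma>\<close> one of \<open>\<gamma>1\<close>, \<open>\<gamma>2\<close>.\<close>

definition rel_degree :: "monodromy_datum \<Rightarrow> monodromy_datum \<Rightarrow> monodromy_datum \<Rightarrow> nat" where
  "rel_degree \<gamma>1 \<gamma>2 \<gamma> = lcm_modulus \<gamma>1 \<gamma>2 div modulus \<gamma>"

definition admissible :: "monodromy_datum \<Rightarrow> monodromy_datum \<Rightarrow> bool" where
  "admissible \<gamma>1 \<gamma>2 \<longleftrightarrow>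
     [int (rel_degree \<gamma>1 \<gamma>2 \<gamma>1) * entry \<gamma>1 (npoints \<gamma>1)
        + int (rel_degree \<gamma>1 \<gamma>2 \<gamma>2) * entry \<gamma>2 1 = 0] (mod int (lcm_modulus \<gamma>1 \<gamma>2))"

definition clutch :: "monodromy_datum \<Rightarrow> monodromy_datum \<Rightarrow> monodromy_datum" where
  "clutch \<gamma>1 \<gamma>2 =
     \<lparr> modulus = lcm_modulus \<gamma>1 \<gamma>2,
       npoints = npoints \<gamma>1 + npoints \<gamma>2 - 2,
       entry = (\<lambda>i. if i \<le> npoints \<gamma>1 - 1
                    then int (rel_degree \<gamma>1 \<gamma>2 \<gamma>1) * entry \<gamma>1 i
                    else int (rel_degree \<gamma>1 \<gamma>2 \<gamma>2) * entry \<gamma>2 (i - npoints \<gamma>1 + 2)) \<rparr>"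

text \<open>\<open>pulled_signature \<gamma>\<close> is the signature of \<open>\<gamma>\<close> composed with the projection to Z/mZ.\<close>

definition pulled_signature :: "monodromy_datum \<Rightarrow> int \<Rightarrow> rat" where
  "pulled_signature \<gamma> n = signature \<gamma> (n mod int (modulus \<gamma>))"

definition balanced :: "nat \<Rightarrow> monodromy_datum \<Rightarrow> monodromy_datum \<Rightarrow> bool" where
  "balanced p \<gamma>1 \<gamma>2 \<longleftrightarrow>
     (\<forall>\<oo>\<in>mult_orbit p (lcm_modulus \<gamma>1 \<gamma>2) ` {0..<int (lcm_modulus \<gamma>1 \<gamma>2)}.
      \<forall>\<omega>\<in>\<oo>. \<forall>\<tau>\<in>\<oo>.
        (pulled_signature \<gamma>1 \<omega> > pulled_signature \<gamma>1 \<tau> \<longrightarrow>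
           pulled_signature \<gamma>2 \<omega> \<ge> pulled_signature \<gamma>2 \<tau>) \<and>
        (pulled_signature \<gamma>2 \<omega> > pulled_signature \<gamma>2 \<tau> \<longrightarrow>
           pulled_signature \<gamma>1 \<omega> \<ge> pulled_signature \<gamma>1 \<tau>))"

end

theory Submission
  imports Defs "HOL-Number_Theory.Residues"
begin

text \<open>Spread over the characters \<open>n\<close> modulo \<open>m\<^sub>3\<close>, the polygon of a signature \<open>f\<close> consists of the
  proportions \<open>c\<^sub>k\<close> of those \<open>x\<close> in the orbit of \<open>n\<close> with \<open>f(x) \<ge> k\<close>, for \<open>1 \<le> k \<le> g(n)\<close>, and
  \<open>f\<^sub>3 = f\<^sub>1 + f\<^sub>2 + \<delta>\<close>, where \<open>\<delta> \<in> {0, 1}\<close> is constant on orbits. The shift by \<open>\<delta>\<close> adds the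
  slopes 0 and 1, and \<open>\<delta>(n) = 1\<close> for exactly \<open>\<epsilon>\<close> characters. The sum of the squares of the \<open>c\<^sub>k\<close>
  is, up to a constant, the sum of \<open>min (f x) (f y)\<close> over all pairs in the orbit. Since
  \<open>min (a + c) (b + d) \<ge> min a b + min c d\<close>, with equality iff \<open>a - b\<close> and \<open>c - d\<close> do not have
  opposite signs, equality of the polygons forces the pair to be balanced. Conversely, on each
  orbit of a balanced pair \<open>f\<^sub>1\<close> and \<open>f\<^sub>2\<close> are monotone in \<open>f\<^sub>1 + f\<^sub>2\<close>, so that the c-th largest
  values add up and the multisets of the \<open>c\<^sub>k\<close> do too.\<close>

section \<open>Sizes of superlevel sets\<close>

text \<open>For finite \<open>J\<close> and \<open>h\<close> bounded by \<open>G\<close>, this is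
  the conjugate partition of the values of \<open>h\<close>, padded with zeros to \<open>G\<close>
  parts. Counts in place of proportions keep it within the naturals.\<close>

definition levels :: "'a set \<Rightarrow> ('a \<Rightarrow> nat) \<Rightarrow> nat \<Rightarrow> nat multiset" where
  "levels J h G = image_mset (\<lambda>k. card {j\<in>J. k \<le> h j}) (mset_set {1..G})"

text \<open>Raising \<open>h\<close> by one moves every threshold up by one. The two new thresholds
  are 1, which every point reaches, and \<open>G + 2\<close>, which none reaches.\<close>

lemma levels_shift:
  assumes "finite J" "\<And>j. j \<in> J \<Longrightarrow> h j \<le> G"
  shows "levels J (\<lambda>j. Suc (h j)) (G + 2) = levels J h G + {#0, card J#}"
proof -
  have split: "{1..G + 2} = insert 1 (insert (G + 2) (Suc ` {1..G}))"
  proof (intro equalityI subsetI)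
    fix k assume "k \<in> {1..G + 2}"
    then show "k \<in> insert 1 (insert (G + 2) (Suc ` {1..G}))" by (cases k) auto
  qed auto
  have ni: "(1::nat) \<notin> insert (G + 2) (Suc ` {1..G})" "G + 2 \<notin> Suc ` {1..G}" by auto
  have mset: "mset_set {1..G + 2} = {#1, G + 2#} + image_mset Suc (mset_set {1..G})"
    unfolding split using ni by (simp add: image_mset_mset_set del: image_Suc_atLeastAtMost)
  have "\<not> G + 2 \<le> Suc (h j)" if "j \<in> J" for j using assms(2)[OF that] by simp
  then have "{j \<in> J. G + 2 \<le> Suc (h j)} = {}" by blast
  then have "card {j \<in> J. G + 2 \<le> Suc (h j)} = 0" by (simp only: card.empty)
  then show ?thesis
    unfolding levels_def mset by (simp add: multiset.map_comp comp_def)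
qed

text \<open>The square of the part at threshold k counts the pairs whose minimum is at least k.
  Summing over k recovers the minimum, because \<open>h\<close> does not exceed
  \<open>G\<close>.\<close>

lemma sum_squares_levels:
  assumes fin: "finite J" and le: "\<And>j. j \<in> J \<Longrightarrow> h j \<le> G"
  shows "(\<Sum>c\<in>#levels J h G. c\<^sup>2) = (\<Sum>i\<in>J. \<Sum>j\<in>J. min (h i) (h j))"
proof -
  have "(\<Sum>c\<in>#levels J h G. c\<^sup>2) = (\<Sum>k=1..G. (card {j\<in>J. k \<le> h j})\<^sup>2)"
    by (simp add: levels_def multiset.map_comp comp_def sum_unfold_sum_mset)
  also have "\<dots> = (\<Sum>k=1..G. \<Sum>i\<in>J. \<Sum>j\<in>J. of_bool (k \<le> min (h i) (h j)))"
  proof (rule sum.cong[OF refl])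
    fix k
    have "card {j\<in>J. k \<le> h j} = (\<Sum>j\<in>J. of_bool (k \<le> h j))"
      using fin by (simp add: Int_def)
    then show "(card {j\<in>J. k \<le> h j})\<^sup>2 = (\<Sum>i\<in>J. \<Sum>j\<in>J. of_bool (k \<le> min (h i) (h j)))"
      by (simp only: power2_eq_square sum_product of_bool_conj[symmetric] min.bounded_iff)
  qed
  also have "\<dots> = (\<Sum>i\<in>J. \<Sum>j\<in>J. \<Sum>k=1..G. of_bool (k \<le> min (h i) (h j)))"
    by (subst sum.swap, rule sum.cong[OF refl], rule sum.swap)
  also have "\<dots> = (\<Sum>i\<in>J. \<Sum>j\<in>J. min (h i) (h j))"
  proof (intro sum.cong refl)
    fix i j assume "i \<in> J" "j \<in> J"
    then have "{1..G} \<inter> {k. k \<le> min (h i) (h j)} = {1..min (h i) (h j)}"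
      using le by (force simp: min_le_iff_disj)
    then show "(\<Sum>k=1..G. of_bool (k \<le> min (h i) (h j))) = min (h i) (h j)"
      by (simp del: min.bounded_iff)
  qed
  finally show ?thesis .
qed

lemma min_add_le:
  fixes a b c d :: nat
  shows "min a b + min c d \<le> min (a + c) (b + d)"
  by (simp add: min_def)

lemma min_add_eq_iff:
  fixes a b c d :: nat
  shows "min (a + c) (b + d) = min a b + min c d \<longleftrightarrow> (a > b \<longrightarrow> c \<ge> d) \<and> (c > d \<longrightarrow> a \<ge> b)"
  by (auto simp: min_def)

definition comonotone_on :: "'a set \<Rightarrow> ('a \<Rightarrow> 'b::linorder) \<Rightarrow> ('a \<Rightarrow> 'b) \<Rightarrow> bool" where
  "comonotone_on J f g \<longleftrightarrow>
     (\<forall>i\<in>J. \<forall>j\<in>J. (f i > f j \<longrightarrow> g i \<ge> g j) \<and> (g i > g j \<longrightarrow> f i \<ge> f j))"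

text \<open>Tail counts are the convenient data for \<open>levels\<close>: for c between 1 and
  \<open>card J\<close>, the number of parts of size at least c is the c-th largest value of
  \<open>h\<close>.\<close>

lemma size_ge_mset_eqI:
  fixes M N :: "nat multiset"
  assumes "\<And>c. size {#x \<in># M. c \<le> x#} = size {#x \<in># N. c \<le> x#}"
  shows "M = N"
proof (rule multiset_eqI)
  fix c
  have "count P c = size {#x \<in># P. c \<le> x#} - size {#x \<in># P. Suc c \<le> x#}" for P :: "nat multiset"
  proof -
    have "{#x \<in># P. c \<le> x#} = {#x \<in># P. x = c#} + {#x \<in># P. Suc c \<le> x#}"
      by (rule multiset_eqI) auto
    then show ?thesis by (simp add: filter_eq_replicate_mset)
  qed
  then show "count M c = count N c" using assms by simp
qed

text \<open>The two cardinality bounds say that \<open>h x\<close> is the c-th largest value. Hence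
  the part at threshold k has size at least c exactly when k is at most \<open>h x\<close>.\<close>

lemma size_ge_levels:
  assumes "finite J" "\<And>j. j \<in> J \<Longrightarrow> h j \<le> G" "x \<in> J"
    and "c \<le> card {j\<in>J. h x \<le> h j}" "card {j\<in>J. h x < h j} < c"
  shows "size {#y \<in># levels J h G. c \<le> y#} = h x"
proof -
  have "c \<le> card {j\<in>J. k \<le> h j} \<longleftrightarrow> k \<le> h x" for k
  proof
    assume "k \<le> h x"
    then have "card {j\<in>J. h x \<le> h j} \<le> card {j\<in>J. k \<le> h j}"
      using assms(1) by (intro card_mono) auto
    with assms(4) show "c \<le> card {j\<in>J. k \<le> h j}" by simp
  next
    assume *: "c \<le> card {j\<in>J. k \<le> h j}"
    show "k \<le> h x"
    proof (rule ccontr)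
      assume "\<not> k \<le> h x"
      then have "card {j\<in>J. k \<le> h j} \<le> card {j\<in>J. h x < h j}"
        using assms(1) by (intro card_mono) auto
      with * assms(5) show False by simp
    qed
  qed
  moreover have "{k. 1 \<le> k \<and> k \<le> G \<and> k \<le> h x} = {1..h x}"
    using assms(2,3) by force
  ultimately show ?thesis
    by (simp add: levels_def filter_mset_image_mset filter_mset_mset_set Collect_conj_eq[symmetric] conj_assoc)
qed

text \<open>Both functions are monotone in their sum. So a point where the sum takes its c-th
  largest value is also one where \<open>h1\<close> and \<open>h2\<close> take theirs, and the three
  tail counts at c add up.\<close>

lemma levels_add_comonotone:
  assumes fin: "finite J" and le1: "\<And>j. j \<in> J \<Longrightarrow> h1 j \<le> G1" and le2: "\<And>j. j \<in> J \<Longrightarrow> h2 j \<le> G2"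
    and com: "comonotone_on J h1 h2"
  shows "levels J (\<lambda>j. h1 j + h2 j) (G1 + G2) = levels J h1 G1 + levels J h2 G2"
proof (rule size_ge_mset_eqI)
  fix c
  let ?s = "\<lambda>j. h1 j + h2 j"
  have card_le: "card {j\<in>J. k \<le> h j} \<le> card J" for k :: nat and h
    using fin by (intro card_mono) auto
  consider "c = 0" | "c > card J" | "c \<noteq> 0" "c \<le> card J" by linarith
  then show "size {#x \<in># levels J ?s (G1 + G2). c \<le> x#} = size {#x \<in># levels J h1 G1 + levels J h2 G2. c \<le> x#}"
  proof cases
    case 1
    then show ?thesis by (simp add: levels_def)
  next
    case 2
    then have "\<not> c \<le> card {j\<in>J. k \<le> h j}" for k :: nat and h
      using card_le[of k h] by linarith
    then have "{#x \<in># levels J h G. c \<le> x#} = {#}" for h :: "'a \<Rightarrow> nat" and G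
      by (auto simp: levels_def filter_mset_eq_conv filter_mset_image_mset)
    then show ?thesis by (simp only: filter_union_mset) simp
  next
    case 3
    \<comment> \<open>These are the points at which the sum is at most its c-th largest value, so a
      maximum of the sum over \<open>A\<close> attains that value.\<close>
    define A where "A = {x\<in>J. c \<le> card {j\<in>J. ?s x \<le> ?s j}}"
    have "finite A" using fin by (simp add: A_def)
    have "J \<noteq> {}" using 3 by auto
    then obtain y where y: "y \<in> J" "\<forall>j\<in>J. ?s y \<le> ?s j"
      using ex_is_arg_min_if_finite[OF fin, of ?s] by (auto simp: is_arg_min_linorder)
    then have "{j\<in>J. ?s y \<le> ?s j} = J" by auto
    with y 3 have "y \<in> A" by (simp add: A_def)
    then have "Max (?s ` A) \<in> ?s ` A" using \<open>finite A\<close> by (intro Max_in) auto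
    then obtain x where "x \<in> A" "?s x = Max (?s ` A)" by auto
    then have x: "x \<in> A" "\<And>z. z \<in> A \<Longrightarrow> ?s z \<le> ?s x"
      using \<open>finite A\<close> by simp_all
    have xJ: "x \<in> J" and ge: "c \<le> card {j\<in>J. ?s x \<le> ?s j}" using x(1) by (auto simp: A_def)
    have lt: "card {j\<in>J. ?s x < ?s j} < c"
    proof (cases "{j\<in>J. ?s x < ?s j} = {}")
      case True
      show ?thesis unfolding True using 3 by simp
    next
      case False
      moreover have "finite {j\<in>J. ?s x < ?s j}" using fin by simp
      \<comment> \<open>The point z takes the least value above that of x, so the points strictly
        above x are those not below z. As z lies outside \<open>A\<close>, there are fewer than c of
        them.\<close>
      ultimately obtain z where z: "z \<in> {j\<in>J. ?s x < ?s j}" "\<forall>j\<in>{j\<in>J. ?s x < ?s j}. ?s z \<le> ?s j"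
        using ex_is_arg_min_if_finite[of "{j\<in>J. ?s x < ?s j}" ?s] by (auto simp: is_arg_min_linorder)
      then have "{j\<in>J. ?s x < ?s j} = {j\<in>J. ?s z \<le> ?s j}" by auto
      moreover have "z \<notin> A" using x(2)[of z] z(1) by auto
      ultimately show ?thesis using z(1) by (simp add: A_def)
    qed
    \<comment> \<open>For any \<open>h\<close> monotone in the sum, \<open>h x\<close> is the c-th
      largest value of \<open>h\<close>. This is applied to the sum, to \<open>h1\<close> and to
      \<open>h2\<close>.\<close>
    have sub: "size {#y \<in># levels J h G. c \<le> y#} = h x"
      if "\<And>i j. i \<in> J \<Longrightarrow> j \<in> J \<Longrightarrow> ?s i \<le> ?s j \<Longrightarrow> h i \<le> h j" "\<And>j. j \<in> J \<Longrightarrow> h j \<le> G" for h G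
    proof (rule size_ge_levels[OF fin that(2) xJ])
      have "card {j\<in>J. ?s x \<le> ?s j} \<le> card {j\<in>J. h x \<le> h j}"
        using that(1)[OF xJ] fin by (intro card_mono) auto
      then show "c \<le> card {j\<in>J. h x \<le> h j}" using ge by simp
      have "card {j\<in>J. h x < h j} \<le> card {j\<in>J. ?s x < ?s j}"
        using that(1)[OF _ xJ] fin by (intro card_mono) (auto simp: not_le[symmetric])
      then show "card {j\<in>J. h x < h j} < c" using lt by simp
    qed
    have "size {#x \<in># levels J ?s (G1 + G2). c \<le> x#} = ?s x"
      using le1 le2 by (intro sub) (simp_all add: add_mono)
    moreover have "size {#x \<in># levels J h1 G1. c \<le> x#} = h1 x"
      using com le1 by (intro sub) (unfold comonotone_on_def, force+)
    moreover have "size {#x \<in># levels J h2 G2. c \<le> x#} = h2 x"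
      using com le2 by (intro sub) (unfold comonotone_on_def, force+)
    ultimately show ?thesis by simp
  qed
qed

section \<open>Signatures\<close>

text \<open>The truncation loses nothing where the signature is a natural number;
  \<open>signature_in_Nats\<close> shows this for generalized monodromy data.\<close>

definition nat_signature :: "monodromy_datum \<Rightarrow> int \<Rightarrow> nat" where
  "nat_signature \<gamma> n = nat \<lfloor>signature \<gamma> n\<rfloor>"

text \<open>\<open>rank \<gamma> n\<close> is \<open>g(\<tau>\<^sub>n)\<close>.\<close>

definition rank :: "monodromy_datum \<Rightarrow> int \<Rightarrow> nat" where
  "rank \<gamma> n = nat_signature \<gamma> n + nat_signature \<gamma> (- n)"

lemma frac_of_int_divide_cong:
  fixes a b :: int and m :: nat
  assumes "[a = b] (mod int m)"
  shows "frac (of_int a / of_nat m :: rat) = frac (of_int b / of_nat m)"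
proof (cases "m = 0")
  case False
  from assms obtain k where "a = b + int m * k"
    by (metis cong_iff_lin cong_sym)
  then have "of_int a / of_nat m = (of_int b / of_nat m + of_int k :: rat)"
    using False by (simp add: field_simps)
  then show ?thesis by simp
qed simp

lemma of_int_divide_in_Ints_iff:
  fixes a :: int and m :: nat
  assumes "m > 0"
  shows "(of_int a / of_nat m :: rat) \<in> \<int> \<longleftrightarrow> int m dvd a"
  using of_int_div_of_int_in_Ints_iff[of a "int m", where ?'a = rat] assms by simp

lemma signature_cong:
  assumes "[n = n'] (mod int (modulus \<gamma>))"
  shows "signature \<gamma> n = signature \<gamma> n'"
proof -
  have "int (modulus \<gamma>) dvd n \<longleftrightarrow> int (modulus \<gamma>) dvd n'"
    using assms by (rule cong_dvd_iff)
  moreover have "frac (of_int (- n * entry \<gamma> i) / of_nat (modulus \<gamma>) :: rat)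
      = frac (of_int (- n' * entry \<gamma> i) / of_nat (modulus \<gamma>))" for i
    using assms by (intro frac_of_int_divide_cong cong_mult cong_minus_minus_iff[THEN iffD2] cong_refl)
  ultimately show ?thesis by (simp add: signature_def)
qed

lemma pulled_signature_eq: "pulled_signature \<gamma> n = signature \<gamma> n"
  unfolding pulled_signature_def by (rule signature_cong) (simp add: cong_def)

lemma nat_signature_cong:
  "[n = n'] (mod int (modulus \<gamma>)) \<Longrightarrow> nat_signature \<gamma> n = nat_signature \<gamma> n'"
  unfolding nat_signature_def by (metis signature_cong)

lemma rank_cong:
  "[n = n'] (mod int (modulus \<gamma>)) \<Longrightarrow> rank \<gamma> n = rank \<gamma> n'"
  unfolding rank_def by (simp add: nat_signature_cong[of n n'] nat_signature_cong[of "-n" "-n'"] cong_minus_minus_iff)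

lemma nat_signature_eq_0: "int (modulus \<gamma>) dvd n \<Longrightarrow> nat_signature \<gamma> n = 0"
  by (simp add: nat_signature_def signature_def)

lemma of_nat_nat_signature:
  "signature \<gamma> n \<in> \<nat> \<Longrightarrow> of_nat (nat_signature \<gamma> n) = signature \<gamma> n"
  by (auto simp: nat_signature_def elim: Nats_cases)

text \<open>The fractional parts of y and -y add up to 0 if y is an integer and to 1 otherwise. The
  2 collects the constants of the two signatures.\<close>

lemma signature_add_uminus:
  assumes "modulus \<gamma> > 0" "\<not> int (modulus \<gamma>) dvd n"
  shows "signature \<gamma> n + signature \<gamma> (- n)
    = of_nat (card {i\<in>{1..npoints \<gamma>}. \<not> int (modulus \<gamma>) dvd n * entry \<gamma> i}) - 2"
proof -
  have "frac (of_int (- n * entry \<gamma> i) / of_nat (modulus \<gamma>) :: rat)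
      + frac (of_int (- (- n) * entry \<gamma> i) / of_nat (modulus \<gamma>))
      = of_bool (\<not> int (modulus \<gamma>) dvd n * entry \<gamma> i)" for i
  proof -
    have "of_int (- n * entry \<gamma> i) / of_nat (modulus \<gamma>)
        = - (of_int (n * entry \<gamma> i) / of_nat (modulus \<gamma>) :: rat)" by simp
    then show ?thesis
      using of_int_divide_in_Ints_iff[OF assms(1), of "n * entry \<gamma> i"]
      by (simp only: frac_neg minus_minus) (auto simp: frac_eq_0_iff)
  qed
  then have "(\<Sum>i=1..npoints \<gamma>. frac (of_int (- n * entry \<gamma> i) / of_nat (modulus \<gamma>)) :: rat)
      + (\<Sum>i=1..npoints \<gamma>. frac (of_int (- (- n) * entry \<gamma> i) / of_nat (modulus \<gamma>)))
      = (\<Sum>i=1..npoints \<gamma>. of_bool (\<not> int (modulus \<gamma>) dvd n * entry \<gamma> i))"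
    by (simp only: sum.distrib[symmetric])
  also have "\<dots> = of_nat (card {i\<in>{1..npoints \<gamma>}. \<not> int (modulus \<gamma>) dvd n * entry \<gamma> i})"
    by (simp add: Int_def)
  finally show ?thesis using assms(2) by (simp add: signature_def)
qed

text \<open>A unit does not change which products n a(i) are divisible by m, and g only counts
  these. In particular g is constant on the orbits of p.\<close>

lemma rank_mult_coprime:
  assumes m: "modulus \<gamma> > 0" and nat: "\<And>n. signature \<gamma> n \<in> \<nat>" and cop: "coprime q (int (modulus \<gamma>))"
  shows "rank \<gamma> (q * n) = rank \<gamma> n"
proof -
  have dvd: "int (modulus \<gamma>) dvd q * k \<longleftrightarrow> int (modulus \<gamma>) dvd k" for k
    using cop by (simp add: coprime_dvd_mult_right_iff coprime_commute)
  show ?thesis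
  proof (cases "int (modulus \<gamma>) dvd n")
    case True
    then show ?thesis by (simp add: rank_def nat_signature_eq_0)
  next
    case False
    then have "signature \<gamma> (q * n) + signature \<gamma> (- (q * n)) = signature \<gamma> n + signature \<gamma> (- n)"
      using m dvd[of n] by (simp add: signature_add_uminus mult.assoc dvd)
    then have "(of_nat (rank \<gamma> (q * n)) :: rat) = of_nat (rank \<gamma> n)"
      using nat by (simp add: rank_def of_nat_nat_signature)
    then show ?thesis by (simp only: of_nat_eq_iff)
  qed
qed

text \<open>The sum of the fractional parts differs by an integer from -n/m times the sum of the
  entries, so it is an integer. If it vanished, m would divide n m and all n a(i), hence n times
  their gcd 1. So it is at least 1 for n nonzero modulo m.\<close>

lemma signature_in_Nats:
  assumes "generalized_monodromy_datum \<gamma>"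
  shows "signature \<gamma> n \<in> \<nat>"
proof (cases "int (modulus \<gamma>) dvd n")
  case True
  then show ?thesis by (simp add: signature_def)
next
  case False
  define m where "m = modulus \<gamma>"
  define x :: "nat \<Rightarrow> rat" where "x i = of_int (- n * entry \<gamma> i) / of_nat m" for i
  define I where "I = {1..npoints \<gamma>}"
  define s where "s = (\<Sum>i\<in>I. frac (x i))"
  have m: "m > 0" and gcd: "Gcd (insert (int m) (entry \<gamma> ` I)) = 1"
    and sum0: "int m dvd (\<Sum>i\<in>I. entry \<gamma> i)"
    using assms by (auto simp: generalized_monodromy_datum_def m_def I_def cong_0_iff)
  have "(\<Sum>i\<in>I. x i) = of_int (- n * (\<Sum>i\<in>I. entry \<gamma> i)) / of_nat m"
    by (simp add: x_def sum_divide_distrib sum_distrib_left sum_negf)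
  also have "\<dots> \<in> \<int>"
    using of_int_divide_in_Ints_iff[OF m] sum0 by (meson dvd_mult)
  finally have "(\<Sum>i\<in>I. x i) - (\<Sum>i\<in>I. of_int \<lfloor>x i\<rfloor>) \<in> \<int>"
    by (rule Ints_diff) (rule Ints_sum, rule Ints_of_int)
  then have "s \<in> \<int>" by (simp add: s_def frac_def sum_subtractf)
  then obtain k where k: "s = of_int k" by (auto elim: Ints_cases)
  have "\<exists>i\<in>I. x i \<notin> \<int>"
  proof (rule ccontr)
    assume "\<not> ?thesis"
    then have "int m dvd n * entry \<gamma> i" if "i \<in> I" for i
      using that of_int_divide_in_Ints_iff[OF m, of "- n * entry \<gamma> i"] by (auto simp: x_def)
    then have "int m dvd Gcd ((*) n ` insert (int m) (entry \<gamma> ` I))"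
      by (intro Gcd_greatest) auto
    also have "\<dots> dvd n * Gcd (insert (int m) (entry \<gamma> ` I))"
      by (simp only: Gcd_mult) simp
    finally show False using gcd False by (simp add: m_def)
  qed
  then obtain i where "i \<in> I" "frac (x i) > 0" by auto
  then have "s > 0"
    unfolding s_def by (intro sum_pos2[of I i]) (auto simp: I_def)
  then have "k \<ge> 1" using k by simp
  moreover have "signature \<gamma> n = s - 1"
    using False by (simp add: signature_def s_def x_def m_def I_def)
  ultimately have "signature \<gamma> n = of_nat (nat (k - 1))" using k by simp
  then show ?thesis by simp
qed

section \<open>The effect of clutching on the signature\<close>

text \<open>The characters at which clutching raises the sum of the two signatures by one. There
  both summands lost at the node are zero, while their sum is one if \<open>n a\<^sub>1(N\<^sub>1)\<close> is not
  divisible by \<open>m\<^sub>1\<close>.\<close>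

definition node_defect :: "monodromy_datum \<Rightarrow> monodromy_datum \<Rightarrow> int \<Rightarrow> bool" where
  "node_defect \<gamma>1 \<gamma>2 n \<longleftrightarrow>
     \<not> int (modulus \<gamma>1) dvd n \<and> \<not> int (modulus \<gamma>2) dvd n \<and>
     int (modulus \<gamma>1) dvd n * entry \<gamma>1 (npoints \<gamma>1)"

lemma node_defect_uminus: "node_defect \<gamma>1 \<gamma>2 (- n) \<longleftrightarrow> node_defect \<gamma>1 \<gamma>2 n"
  by (simp add: node_defect_def)

lemma node_defect_mult_coprime:
  assumes "coprime q (int (modulus \<gamma>1))" "coprime q (int (modulus \<gamma>2))"
  shows "node_defect \<gamma>1 \<gamma>2 (q * n) \<longleftrightarrow> node_defect \<gamma>1 \<gamma>2 n"
  using assms by (simp add: node_defect_def mult.assoc coprime_dvd_mult_right_iff coprime_commute)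

lemma lcm_modulus_eq:
  "lcm_modulus \<gamma>1 \<gamma>2 = rel_degree \<gamma>1 \<gamma>2 \<gamma>1 * modulus \<gamma>1"
  "lcm_modulus \<gamma>1 \<gamma>2 = rel_degree \<gamma>1 \<gamma>2 \<gamma>2 * modulus \<gamma>2"
  by (simp_all add: rel_degree_def lcm_modulus_def)

text \<open>Scaling the entries by d_i and the modulus to m_3 leaves the fractional parts unchanged,
  so only the two terms at the node are lost. Two constants -1 become one, which gains 1; the node
  terms sum to 1 or 0 and cancel this gain or not. If m_1 or m_2 divides n, the corresponding
  signature is 0 by convention and the node terms vanish.\<close>

lemma signature_clutch:
  assumes m1: "modulus \<gamma>1 > 0" and m2: "modulus \<gamma>2 > 0" and N1: "npoints \<gamma>1 \<ge> 2" and N2: "npoints \<gamma>2 \<ge> 2"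
    and adm: "admissible \<gamma>1 \<gamma>2"
  shows "signature (clutch \<gamma>1 \<gamma>2) n
    = signature \<gamma>1 n + signature \<gamma>2 n + of_bool (node_defect \<gamma>1 \<gamma>2 n)"
proof -
  define M1 M2 M where "M1 = modulus \<gamma>1" "M2 = modulus \<gamma>2" "M = lcm_modulus \<gamma>1 \<gamma>2"
  define D1 D2 where "D1 = rel_degree \<gamma>1 \<gamma>2 \<gamma>1" "D2 = rel_degree \<gamma>1 \<gamma>2 \<gamma>2"
  define a b where "a = entry \<gamma>1 (npoints \<gamma>1)" "b = entry \<gamma>2 1"
  note defs = M1_M2_M_def D1_D2_def a_b_def
  have M: "M = D1 * M1" "M = D2 * M2" unfolding defs by (rule lcm_modulus_eq)+
  have "M > 0" using m1 m2 by (simp add: defs lcm_modulus_def lcm_pos_nat)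
  then have pos: "D1 > 0" "D2 > 0" "M1 > 0" "M2 > 0" using M by (auto intro: Nat.gr0I)
  have dvdM: "int M dvd n \<longleftrightarrow> int M1 dvd n \<and> int M2 dvd n"
    by (simp add: defs lcm_modulus_def flip: lcm_int_int_eq)
  define x1 x2 :: "nat \<Rightarrow> rat"
    where "x1 i = frac (of_int (- n * entry \<gamma>1 i) / of_nat M1)"
      and "x2 i = frac (of_int (- n * entry \<gamma>2 i) / of_nat M2)" for i
  let ?N1 = "npoints \<gamma>1" and ?N2 = "npoints \<gamma>2"
  have scale1: "of_int (- n * (int D1 * c)) / of_nat M = (of_int (- n * c) / of_nat M1 :: rat)" for c
    using pos by (simp add: M(1))
  have scale2: "of_int (- n * (int D2 * c)) / of_nat M = (of_int (- n * c) / of_nat M2 :: rat)" for c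
    using pos by (simp add: M(2))
  have "(\<Sum>i=1..?N1 + ?N2 - 2. frac (of_int (- n * entry (clutch \<gamma>1 \<gamma>2) i) / of_nat M))
     = (\<Sum>i=1..?N1 - 1. x1 i) + (\<Sum>i=?N1..?N1 + ?N2 - 2. x2 (i - ?N1 + 2))"
  proof -
    have split: "{1..?N1 + ?N2 - 2} = {1..?N1 - 1} \<union> {?N1..?N1 + ?N2 - 2}"
      using N1 N2 by auto
    have "frac (of_int (- n * entry (clutch \<gamma>1 \<gamma>2) i) / of_nat M) = x1 i" if "i \<le> ?N1 - 1" for i
    proof -
      have "entry (clutch \<gamma>1 \<gamma>2) i = int D1 * entry \<gamma>1 i" using that by (simp add: clutch_def D1_D2_def)
      then show ?thesis by (simp only: scale1 x1_def)
    qed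
    moreover have "frac (of_int (- n * entry (clutch \<gamma>1 \<gamma>2) i) / of_nat M) = x2 (i - ?N1 + 2)" if "?N1 \<le> i" for i
    proof -
      have "entry (clutch \<gamma>1 \<gamma>2) i = int D2 * entry \<gamma>2 (i - ?N1 + 2)"
        using that N1 unfolding clutch_def D1_D2_def by (auto simp: not_le)
      then show ?thesis by (simp only: scale2 x2_def)
    qed
    moreover have "{1..?N1 - 1} \<inter> {?N1..?N1 + ?N2 - 2} = {}" using N1 by auto
    ultimately show ?thesis
      unfolding split by (subst sum.union_disjoint) simp_all
  qed
  also have "(\<Sum>i=?N1..?N1 + ?N2 - 2. x2 (i - ?N1 + 2)) = (\<Sum>i=2..?N2. x2 i)"
    using N1 N2
    by (intro sum.reindex_bij_witness[of _ "\<lambda>i. i + ?N1 - 2" "\<lambda>i. i - ?N1 + 2"]) auto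
  also have "(\<Sum>i=1..?N1 - 1. x1 i) = (\<Sum>i=1..?N1. x1 i) - x1 ?N1"
    using N1 by (cases ?N1) auto
  also have "(\<Sum>i=2..?N2. x2 i) = (\<Sum>i=1..?N2. x2 i) - x2 1"
    using N2 by (simp add: sum.atLeast_Suc_atMost numeral_2_eq_2)
  finally have sum: "(\<Sum>i=1..?N1 + ?N2 - 2. frac (of_int (- n * entry (clutch \<gamma>1 \<gamma>2) i) / of_nat M))
     = (\<Sum>i=1..?N1. x1 i) + (\<Sum>i=1..?N2. x2 i) - (x1 ?N1 + x2 1)" by simp
  have "int M dvd int D1 * a + int D2 * b"
    using adm by (simp add: admissible_def defs cong_0_iff)
  then have "int M dvd - n * (int D1 * a + int D2 * b)" by simp
  then have "of_int (- n * (int D1 * a + int D2 * b)) / of_nat M \<in> (\<int> :: rat set)"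
    using of_int_divide_in_Ints_iff[OF \<open>M > 0\<close>] by blast
  moreover have "of_int (- n * (int D1 * a + int D2 * b)) / of_nat M
     = (of_int (- n * a) / of_nat M1 + of_int (- n * b) / of_nat M2 :: rat)"
    by (simp only: distrib_left of_int_add add_divide_distrib scale1 scale2)
  \<comment> \<open>By admissibility the arguments of the two node terms add up to an integer, so
    their fractional parts sum to 0 or 1.\<close>
  ultimately obtain k where k: "of_int (- n * b) / of_nat M2 = (of_int k - of_int (- n * a) / of_nat M1 :: rat)"
    by (metis Ints_cases add_diff_cancel_left')
  have "x2 1 = frac (- (of_int (- n * a) / of_nat M1))"
    using frac_add_of_int_left[of k "- (of_int (- n * a) / of_nat M1 :: rat)"] k by (simp add: x2_def a_b_def)
  then have node: "x1 ?N1 + x2 1 = of_bool (\<not> int M1 dvd n * a)"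
    using of_int_divide_in_Ints_iff[OF pos(3), of "- n * a"]
    by (simp only: x1_def a_b_def(1)[symmetric] frac_neg) auto
  \<comment> \<open>Here \<open>x2 1\<close> vanishes and \<open>x1\<close> is below 1, so the sum,
    which is 0 or 1, must be 0.\<close>
  have node0: "x1 ?N1 + x2 1 = 0" if "int M2 dvd n"
  proof -
    have "int M2 dvd - n * b" using that by simp
    then have "x2 1 = 0"
      using of_int_divide_in_Ints_iff[OF pos(4), of "- n * b"] by (simp add: x2_def a_b_def)
    moreover have "x1 ?N1 < 1" by (simp add: x1_def frac_lt_1)
    ultimately show ?thesis using node by (auto simp: of_bool_def split: if_splits)
  qed
  have zero1: "(\<Sum>i=1..?N1. x1 i) = 0" if "int M1 dvd n"
    using that of_int_divide_in_Ints_iff[OF pos(3)] by (intro sum.neutral) (auto simp: x1_def simp del: of_int_mult of_int_minus)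
  have zero2: "(\<Sum>i=1..?N2. x2 i) = 0" if "int M2 dvd n"
    using that of_int_divide_in_Ints_iff[OF pos(4)] by (intro sum.neutral) (auto simp: x2_def simp del: of_int_mult of_int_minus)
  have sig3: "signature (clutch \<gamma>1 \<gamma>2) n = (if int M dvd n then 0
     else - 1 + ((\<Sum>i=1..?N1. x1 i) + (\<Sum>i=1..?N2. x2 i) - (x1 ?N1 + x2 1)))"
    using sum by (simp add: signature_def M1_M2_M_def clutch_def)
  have sig1: "signature \<gamma>1 n = (if int M1 dvd n then 0 else - 1 + (\<Sum>i=1..?N1. x1 i))"
    by (simp add: signature_def x1_def M1_M2_M_def)
  have sig2: "signature \<gamma>2 n = (if int M2 dvd n then 0 else - 1 + (\<Sum>i=1..?N2. x2 i))"
    by (simp add: signature_def x2_def M1_M2_M_def)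
  have defect: "node_defect \<gamma>1 \<gamma>2 n \<longleftrightarrow> \<not> int M1 dvd n \<and> \<not> int M2 dvd n \<and> int M1 dvd n * a"
    by (simp add: node_defect_def defs)
  show ?thesis
    unfolding sig1 sig2 sig3 defect dvdM
    using node node0 zero1 zero2 by (cases "int M1 dvd n"; cases "int M2 dvd n") auto
qed

section \<open>Polygons as averages over powers of p\<close>

text \<open>The period \<open>K\<close> may be any positive multiple of the order of p, so that a
  period modulo m_3 is also one modulo m_1 and m_2.\<close>

locale frobenius_period =
  fixes p m K :: nat
  assumes m_pos: "m > 0" and K_pos: "K > 0" and power_K: "[int p ^ K = 1] (mod int m)"
begin

lemma coprime_p: "coprime (int p) (int m)"
proof -
  have "coprime (int p ^ K) (int m)"
    using power_K by (metis cong_imp_coprime cong_sym coprime_1_left)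
  then show ?thesis using K_pos by (simp add: coprime_power_left_iff)
qed

lemma power_mult_K: "[int p ^ (K * k + j) * n = int p ^ j * n] (mod int m)"
proof -
  have "[(int p ^ K) ^ k * int p ^ j * n = 1 ^ k * int p ^ j * n] (mod int m)"
    by (intro cong_mult cong_pow power_K cong_refl)
  then show ?thesis by (simp add: power_add power_mult)
qed

lemma mult_orbit_subset: "mult_orbit p m n \<subseteq> {0..<int m}"
  using m_pos by (auto simp: mult_orbit_def)

lemma finite_mult_orbit: "finite (mult_orbit p m n)"
  using mult_orbit_subset by (rule finite_subset) simp

lemma self_in_mult_orbit: "n \<in> {0..<int m} \<Longrightarrow> n \<in> mult_orbit p m n"
  by (auto simp: mult_orbit_def intro!: range_eqI[of _ _ 0])

lemma mult_orbit_eq: "mult_orbit p m n = (\<lambda>j. (int p ^ j * n) mod int m) ` {..<K}"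
proof -
  have "(int p ^ k * n) mod int m = (int p ^ (k mod K) * n) mod int m" for k
    using power_mult_K[of "k div K" "k mod K" n] by (simp add: cong_def)
  moreover have "k mod K \<in> {..<K}" for k using K_pos by simp
  ultimately show ?thesis unfolding mult_orbit_def by blast
qed

lemma mult_orbit_closed:
  assumes "x \<in> mult_orbit p m n"
  shows "(int p * x) mod int m \<in> mult_orbit p m n"
proof -
  from assms obtain k where "x = (int p ^ k * n) mod int m" by (auto simp: mult_orbit_def)
  then have "(int p * x) mod int m = (int p ^ Suc k * n) mod int m"
    by (simp add: mod_mult_right_eq mult.assoc)
  then show ?thesis unfolding mult_orbit_def by blast
qed

lemma mult_orbit_cong:
  assumes "x \<in> mult_orbit p m n"
  shows "mult_orbit p m x = mult_orbit p m n"
proof -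
  from assms obtain k where x: "x = (int p ^ k * n) mod int m" by (auto simp: mult_orbit_def)
  have step: "(int p ^ j * x) mod int m = (int p ^ (j + k) * n) mod int m" for j
    by (simp add: x mod_mult_right_eq power_add mult.assoc)
  show ?thesis
  proof (intro equalityI subsetI)
    fix y assume "y \<in> mult_orbit p m x"
    then show "y \<in> mult_orbit p m n" by (auto simp: mult_orbit_def step)
  next
    fix y assume "y \<in> mult_orbit p m n"
    then obtain j where "y = (int p ^ j * n) mod int m" by (auto simp: mult_orbit_def)
    \<comment> \<open>Adding k full periods to the exponent makes it at least k, so the factor
      leading from n to x can be split off without inverting p.\<close>
    also have "\<dots> = (int p ^ (K * k + j) * n) mod int m"
      using power_mult_K[of k j n] by (simp add: cong_def)
    also have "K * k + j = ((K - 1) * k + j) + k"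
      using K_pos by (cases K) auto
    also have "(int p ^ (((K - 1) * k + j) + k) * n) mod int m = (int p ^ ((K - 1) * k + j) * x) mod int m"
      by (rule step[symmetric])
    finally show "y \<in> mult_orbit p m x" unfolding mult_orbit_def by blast
  qed
qed

text \<open>Multiplication by p is injective modulo m and maps the finite orbit into itself, hence
  permutes it.\<close>

lemma sum_mult_orbit_shift:
  assumes f: "\<And>x. f (x mod int m) = f x"
  shows "(\<Sum>x\<in>mult_orbit p m n. f (int p ^ j * x)) = (\<Sum>x\<in>mult_orbit p m n. f x :: nat)"
proof (induction j)
  case (Suc j)
  let ?O = "mult_orbit p m n" and ?g = "\<lambda>x. (int p * x) mod int m"
  have inj: "inj_on ?g ?O"
  proof (rule inj_onI)
    fix x y assume xy: "x \<in> ?O" "y \<in> ?O" "?g x = ?g y"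
    then have "[x = y] (mod int m)"
      using coprime_p by (simp add: cong_def[symmetric] cong_mult_lcancel)
    moreover have "x \<in> {0..<int m}" "y \<in> {0..<int m}" using xy mult_orbit_subset by blast+
    ultimately show "x = y" by (simp add: cong_def)
  qed
  have image: "?g ` ?O = ?O"
    using finite_mult_orbit inj mult_orbit_closed by (intro endo_inj_surj) auto
  have "(\<Sum>x\<in>?O. f (int p ^ Suc j * x)) = (\<Sum>x\<in>?O. f (int p ^ j * ?g x))"
  proof (rule sum.cong[OF refl])
    fix x
    have "f (int p ^ Suc j * x) = f ((int p ^ j * (int p * x)) mod int m)"
      by (simp add: f mult_ac)
    also have "\<dots> = f ((int p ^ j * ?g x) mod int m)" by (simp only: mod_mult_right_eq)
    finally show "f (int p ^ Suc j * x) = f (int p ^ j * ?g x)" by (simp only: f)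
  qed
  also have "\<dots> = (\<Sum>x\<in>?g ` ?O. f (int p ^ j * x))"
    using inj by (simp add: sum.reindex)
  finally show ?case using Suc image by simp
qed simp

text \<open>Multiplying n by p shifts the summation window by one; the term that enters at
  \<open>K\<close> equals the term that leaves at 0.\<close>

lemma sum_powers_shift:
  assumes f: "\<And>x. f (x mod int m) = f x"
  shows "(\<Sum>j<K. f (int p ^ j * (int p ^ k * n))) = (\<Sum>j<K. f (int p ^ j * n) :: nat)"
proof (induction k)
  case (Suc k)
  let ?h = "\<lambda>j. f (int p ^ j * (int p ^ k * n))"
  have "?h K = ?h 0"
    using power_mult_K[of 1 0 "int p ^ k * n"] f by (metis cong_def mult_1_right add_0_right)
  moreover have "(\<Sum>j<Suc K. ?h j) = ?h 0 + (\<Sum>j<K. ?h (Suc j))"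
    by (rule sum.lessThan_Suc_shift)
  ultimately have "(\<Sum>j<K. ?h (Suc j)) = (\<Sum>j<K. ?h j)" by simp
  moreover have "?h (Suc j) = f (int p ^ j * (int p ^ Suc k * n))" for j
    by (simp add: mult_ac)
  ultimately show ?case using Suc by simp
qed simp

text \<open>Double counting of f(p^j x) over j below \<open>K\<close> and x in the orbit: for fixed
  j the sum over x is the orbit sum, for fixed x the sum over j is the sum over powers.\<close>

lemma mult_orbit_average:
  assumes f: "\<And>x. f (x mod int m) = f x"
  shows "K * (\<Sum>x\<in>mult_orbit p m n. f x) = card (mult_orbit p m n) * (\<Sum>j<K. f (int p ^ j * n) :: nat)"
proof -
  let ?O = "mult_orbit p m n"
  have "K * (\<Sum>x\<in>?O. f x) = (\<Sum>j<K. \<Sum>x\<in>?O. f (int p ^ j * x))"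
    by (simp add: sum_mult_orbit_shift[of f, OF f])
  also have "\<dots> = (\<Sum>x\<in>?O. \<Sum>j<K. f (int p ^ j * x))" by (rule sum.swap)
  also have "\<dots> = (\<Sum>x\<in>?O. \<Sum>j<K. f (int p ^ j * n))"
  proof (rule sum.cong[OF refl])
    fix x assume "x \<in> ?O"
    then obtain k where x: "x = (int p ^ k * n) mod int m" by (auto simp: mult_orbit_def)
    have "f (int p ^ j * x) = f (int p ^ j * (int p ^ k * n))" for j
      by (metis f x mod_mult_right_eq)
    then show "(\<Sum>j<K. f (int p ^ j * x)) = (\<Sum>j<K. f (int p ^ j * n))"
      using sum_powers_shift[of f k n, OF f] by simp
  qed
  also have "\<dots> = card ?O * (\<Sum>j<K. f (int p ^ j * n))" by simp
  finally show ?thesis .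
qed

lemma mult_orbit_proportion:
  assumes Q: "\<And>x. Q (x mod int m) = Q x"
  shows "(of_nat (card {j\<in>{..<K}. Q (int p ^ j * n)}) / of_nat K :: rat)
    = of_nat (card {x\<in>mult_orbit p m n. Q x}) / of_nat (card (mult_orbit p m n))"
proof -
  let ?O = "mult_orbit p m n"
  have "K * card {x\<in>?O. Q x} = card ?O * card {j\<in>{..<K}. Q (int p ^ j * n)}"
    using mult_orbit_average[of "\<lambda>x. of_bool (Q x)" n] Q finite_mult_orbit by (simp add: Int_def)
  then have "of_nat K * of_nat (card {x\<in>?O. Q x})
      = (of_nat (card ?O) * of_nat (card {j\<in>{..<K}. Q (int p ^ j * n)}) :: rat)"
    by (simp only: of_nat_mult[symmetric])
  moreover have "card ?O > 0"
    using finite_mult_orbit by (auto simp: card_gt_0_iff mult_orbit_def)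
  ultimately show ?thesis using K_pos by (simp add: field_simps)
qed

end

section \<open>Sums of multisets, telescoping and sorted lists\<close>

lemma sum_replicate_mset:
  "finite A \<Longrightarrow> (\<Sum>k\<in>A. replicate_mset c (f k)) = repeat_mset c (image_mset f (mset_set A))"
  by (induction A rule: finite_induct) auto

lemma sum_constant_mset:
  "finite A \<Longrightarrow> (\<Sum>x\<in>A. M) = repeat_mset (card A) (M :: 'a multiset)"
  by (induction A rule: finite_induct) auto

lemma repeat_replicate_mset: "repeat_mset c (replicate_mset d x) = replicate_mset (c * d) x"
  by (rule multiset_eqI) simp

text \<open>Applied to the decreasing values E(t), this joins the blocks of equal slopes into one
  sum over all thresholds from 1 to g.\<close>

lemma sum_Ioc_telescope:
  fixes e :: "nat \<Rightarrow> nat" and F :: "nat \<Rightarrow> 'a::comm_monoid_add"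
  assumes "\<And>i j. i \<le> j \<Longrightarrow> j \<le> s \<Longrightarrow> e j \<le> e i"
  shows "(\<Sum>t<s. \<Sum>k\<in>{e (Suc t)<..e t}. F k) = (\<Sum>k\<in>{e s<..e 0}. F k)"
  using assms
proof (induction s)
  case (Suc s)
  have "{e (Suc s)<..e 0} = {e s<..e 0} \<union> {e (Suc s)<..e s}"
    using Suc.prems[of s "Suc s"] Suc.prems[of 0 s] by auto
  moreover have "{e s<..e 0} \<inter> {e (Suc s)<..e s} = {}" by auto
  ultimately have "(\<Sum>k\<in>{e (Suc s)<..e 0}. F k) = (\<Sum>k\<in>{e s<..e 0}. F k) + (\<Sum>k\<in>{e (Suc s)<..e s}. F k)"
    by (simp add: sum.union_disjoint)
  then show ?case using Suc by simp
qed simp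

lemma sorted_list_of_set_of_nat:
  "finite A \<Longrightarrow> sorted_list_of_set ((of_nat :: nat \<Rightarrow> 'a::linordered_semidom) ` A) = map of_nat (sorted_list_of_set A)"
  by (rule sorted_distinct_set_unique)
     (auto simp: sorted_map distinct_map inj_on_def intro: sorted_wrt_mono_rel[OF _ sorted_sorted_list_of_set])

section \<open>The polygon of a signature as a sum over characters\<close>

text \<open>The slopes that the character \<open>n\<close> contributes. As \<open>j\<close> runs through \<open>{..<K}\<close>, the powers
  \<open>p ^ j\<close> traverse the orbit of \<open>n\<close> a whole number of times, so the proportions over \<open>{..<K}\<close> are
  those over the orbit; one \<open>K\<close> then serves all orbits and all three moduli.\<close>

definition slopes :: "nat \<Rightarrow> nat \<Rightarrow> monodromy_datum \<Rightarrow> int \<Rightarrow> rat multiset" where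
  "slopes p K \<gamma> n = image_mset (\<lambda>c. of_nat c / of_nat K)
     (levels {..<K} (\<lambda>j. nat_signature \<gamma> (int p ^ j * n)) (rank \<gamma> n))"

lemma slopes_cong:
  assumes "[n = n'] (mod int (modulus \<gamma>))"
  shows "slopes p K \<gamma> n = slopes p K \<gamma> n'"
proof -
  have "nat_signature \<gamma> (int p ^ j * n) = nat_signature \<gamma> (int p ^ j * n')" for j
    using assms by (intro nat_signature_cong cong_mult cong_refl)
  then show ?thesis using rank_cong[OF assms] by (simp add: slopes_def)
qed

text \<open>Integrality is assumed directly because for the clutched datum it comes from
  \<open>signature_clutch\<close>.\<close>

locale integral_signature = frobenius_period p "modulus \<gamma>" K for \<gamma> p K +
  assumes signature_Nats: "\<And>n. signature \<gamma> n \<in> \<nat>"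
begin

lemma signature_eq: "signature \<gamma> n = of_nat (nat_signature \<gamma> n)"
  using signature_Nats by (simp add: of_nat_nat_signature)

lemma nat_signature_mod: "nat_signature \<gamma> (x mod int (modulus \<gamma>)) = nat_signature \<gamma> x"
  by (rule nat_signature_cong) (simp add: cong_def)

lemma rank_power: "rank \<gamma> (int p ^ j * n) = rank \<gamma> n"
  using m_pos signature_Nats coprime_p by (intro rank_mult_coprime) auto

lemma nat_signature_le_rank: "nat_signature \<gamma> (int p ^ j * n) \<le> rank \<gamma> n"
  using rank_power[of j n] by (simp add: rank_def)

lemma rank_orbit:
  assumes "x \<in> mult_orbit p (modulus \<gamma>) n"
  shows "rank \<gamma> x = rank \<gamma> n"
proof -
  from assms obtain j where "x = (int p ^ j * n) mod int (modulus \<gamma>)" by (auto simp: mult_orbit_def)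
  then have "rank \<gamma> x = rank \<gamma> (int p ^ j * n)" by (intro rank_cong) (simp add: cong_def)
  then show ?thesis by (simp add: rank_power)
qed

lemma slopes_eq_orbit:
  fixes n :: int
  defines "Q \<equiv> mult_orbit p (modulus \<gamma>) n"
  shows "slopes p K \<gamma> n = image_mset (\<lambda>k. of_nat (card {x\<in>Q. k \<le> nat_signature \<gamma> x}) / of_nat (card Q))
    (mset_set {1..rank \<gamma> n})"
proof -
  have "(of_nat (card {j\<in>{..<K}. k \<le> nat_signature \<gamma> (int p ^ j * n)}) / of_nat K :: rat)
      = of_nat (card {x\<in>Q. k \<le> nat_signature \<gamma> x}) / of_nat (card Q)" for k
    unfolding Q_def by (rule mult_orbit_proportion) (simp only: nat_signature_mod)
  then show ?thesis
    by (simp only: slopes_def levels_def multiset.map_comp comp_def)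
qed

lemma orbit_g_eq: "orbit_g \<gamma> (mult_orbit p (modulus \<gamma>) n) = of_nat (rank \<gamma> n)"
proof -
  have sum: "signature \<gamma> x + signature \<gamma> (- x) = of_nat (rank \<gamma> n)" if "x \<in> mult_orbit p (modulus \<gamma>) n" for x
    using rank_orbit[OF that] by (simp add: signature_eq flip: rank_def of_nat_add)
  moreover have "(n mod int (modulus \<gamma>)) \<in> mult_orbit p (modulus \<gamma>) n"
    by (auto simp: mult_orbit_def intro!: range_eqI[of _ _ 0])
  ultimately show ?thesis
    unfolding orbit_g_def by (intro the_equality) (auto simp del: signature_eq)
qed

lemma orbit_E_eq:
  fixes n :: int
  defines "Q \<equiv> mult_orbit p (modulus \<gamma>) n"
  shows "orbit_E \<gamma> Q = map of_nat
    (rank \<gamma> n # rev (sorted_list_of_set {v \<in> nat_signature \<gamma> ` Q. 1 \<le> v \<and> v < rank \<gamma> n}) @ [0])"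
proof -
  have "{v \<in> signature \<gamma> ` Q. 1 \<le> v \<and> v \<le> orbit_g \<gamma> Q - 1}
      = of_nat ` {v \<in> nat_signature \<gamma> ` Q. 1 \<le> v \<and> v < rank \<gamma> n}"
  proof -
    have "(1 \<le> (of_nat k :: rat) \<and> of_nat k \<le> (of_nat (rank \<gamma> n) - 1 :: rat)) \<longleftrightarrow> 1 \<le> k \<and> k < rank \<gamma> n" for k
    proof -
      have "(of_nat k \<le> (of_nat (rank \<gamma> n) - 1 :: rat)) \<longleftrightarrow> (of_nat (Suc k) :: rat) \<le> of_nat (rank \<gamma> n)"
        by auto
      also have "\<dots> \<longleftrightarrow> k < rank \<gamma> n" by (simp only: of_nat_le_iff Suc_le_eq)
      finally show ?thesis by simp
    qed
    moreover have "signature \<gamma> ` Q = of_nat ` nat_signature \<gamma> ` Q"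
      unfolding image_image by (rule image_cong[OF refl]) (rule signature_eq)
    moreover have "orbit_g \<gamma> Q = of_nat (rank \<gamma> n)" unfolding Q_def by (rule orbit_g_eq)
    ultimately show ?thesis by (simp only:) blast
  qed
  moreover have "finite {v \<in> nat_signature \<gamma> ` Q. 1 \<le> v \<and> v < rank \<gamma> n}" by simp
  ultimately show ?thesis
    unfolding orbit_E_def by (simp add: sorted_list_of_set_of_nat rev_map Q_def orbit_g_eq)
qed

text \<open>For a threshold k with E(t+1) < k <= E(t), the superlevel sets at k and at E(t) agree.
  So the slope of index t, with its multiplicity, amounts to one block of |Q| equal slopes for each
  such k.\<close>

lemma orbit_polygon_eq:
  fixes n :: int
  defines "Q \<equiv> mult_orbit p (modulus \<gamma>) n"
  shows "orbit_polygon \<gamma> Q = repeat_mset (card Q) (slopes p K \<gamma> n)"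
proof -
  define G where "G = rank \<gamma> n"
  define E where "E = G # rev (sorted_list_of_set {v \<in> nat_signature \<gamma> ` Q. 1 \<le> v \<and> v < G}) @ [0]"
  \<comment> \<open>This is one more than the s of the definition: the last entry
    \<open>E ! s\<close> is the final 0, and the slopes have the indices below
    \<open>s\<close>.\<close>
  define s where "s = length E - 1"
  define X :: "nat \<Rightarrow> rat" where "X k = of_nat (card {x\<in>Q. k \<le> nat_signature \<gamma> x}) / of_nat (card Q)" for k
  have finO: "finite Q" unfolding Q_def by (rule finite_mult_orbit)
  have setE: "set E = insert G (insert 0 {v \<in> nat_signature \<gamma> ` Q. 1 \<le> v \<and> v < G})"
    using finO by (auto simp: E_def)
  have "sorted (rev E)"
    using finO by (auto simp: E_def sorted_append)
  then have anti: "E ! j \<le> E ! i" if "i \<le> j" "j \<le> s" for i j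
    using that by (intro sorted_rev_nth_mono) (auto simp: s_def E_def)
  have ends: "E ! 0 = G" "E ! s = 0" by (simp_all add: E_def s_def nth_append)
  have gap: "{x\<in>Q. E ! t \<le> nat_signature \<gamma> x} = {x\<in>Q. k \<le> nat_signature \<gamma> x}"
    if t: "t < s" and k: "k \<in> {E ! Suc t<..E ! t}" for t k
  proof -
    have "E ! t \<le> nat_signature \<gamma> x" if x: "x \<in> Q" "k \<le> nat_signature \<gamma> x" for x
    proof (rule ccontr)
      \<comment> \<open>The value at x would lie strictly between two consecutive entries of
        \<open>E\<close>, although it belongs to the list itself.\<close>
      assume lt: "\<not> E ! t \<le> nat_signature \<gamma> x"
      have "E ! t \<le> G" using anti[of 0 t] t ends by simp
      then have "nat_signature \<gamma> x \<in> set E" using x k lt by (auto simp: setE)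
      moreover have "length E = Suc s" by (simp add: s_def E_def)
      ultimately obtain r where r: "r \<le> s" "E ! r = nat_signature \<gamma> x"
        by (metis in_set_conv_nth less_Suc_eq_le)
      have "r \<le> t"
      proof (rule ccontr)
        assume "\<not> r \<le> t"
        then have "E ! r \<le> E ! Suc t" using r(1) by (intro anti) auto
        then show False using r(2) x k by auto
      qed
      then show False using anti[of r t] t r(2) lt by auto
    qed
    then show ?thesis using k by fastforce
  qed
  have E: "orbit_E \<gamma> Q = map of_nat E"
    unfolding E_def G_def Q_def by (rule orbit_E_eq)
  have "orbit_polygon \<gamma> Q = (\<Sum>t<s. replicate_mset (card Q * (E ! t - E ! Suc t)) (X (E ! t)))"
    unfolding orbit_polygon_def
  proof (rule sum.cong)
    fix t assume "t \<in> {..<s}"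
    then have t: "t < length E" "Suc t < length E" "E ! Suc t \<le> E ! t"
      using anti[of t "Suc t"] by (auto simp: s_def)
    then have "of_nat (card Q) * (of_nat (E ! t) - of_nat (E ! Suc t))
        = (of_nat (card Q * (E ! t - E ! Suc t)) :: rat)"
      by (simp add: of_nat_diff)
    moreover have "orbit_slope \<gamma> Q t = X (E ! t)"
      using t by (simp add: orbit_slope_def E X_def signature_eq)
    ultimately show "replicate_mset (nat \<lfloor>of_nat (card Q) * (orbit_E \<gamma> Q ! t - orbit_E \<gamma> Q ! (t + 1))\<rfloor>) (orbit_slope \<gamma> Q t)
        = replicate_mset (card Q * (E ! t - E ! Suc t)) (X (E ! t))"
      using t by (simp only: E nth_map Suc_eq_plus1[symmetric] floor_of_nat nat_int)
  qed (simp add: E s_def)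
  also have "\<dots> = (\<Sum>t<s. \<Sum>k\<in>{E ! Suc t<..E ! t}. replicate_mset (card Q) (X k))"
  proof (rule sum.cong[OF refl])
    fix t assume "t \<in> {..<s}"
    then have X: "X k = X (E ! t)" if "k \<in> {E ! Suc t<..E ! t}" for k
      using gap[of t k] that by (simp add: X_def)
    have "(\<Sum>k\<in>{E ! Suc t<..E ! t}. replicate_mset (card Q) (X k))
        = (\<Sum>k\<in>{E ! Suc t<..E ! t}. replicate_mset (card Q) (X (E ! t)))"
      by (intro sum.cong refl arg_cong[of _ _ "replicate_mset (card Q)"] X)
    then show "replicate_mset (card Q * (E ! t - E ! Suc t)) (X (E ! t))
        = (\<Sum>k\<in>{E ! Suc t<..E ! t}. replicate_mset (card Q) (X k))"
      by (simp add: sum_replicate_mset image_mset_const_eq repeat_replicate_mset)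
  qed
  also have "\<dots> = (\<Sum>k\<in>{0<..G}. replicate_mset (card Q) (X k))"
    using sum_Ioc_telescope[of s "\<lambda>i. E ! i"] anti ends by simp
  also have "\<dots> = repeat_mset (card Q) (image_mset X (mset_set {1..G}))"
    by (simp add: sum_replicate_mset atLeastSucAtMost_greaterThanAtMost)
  finally show ?thesis
    unfolding slopes_eq_orbit Q_def[symmetric] G_def[symmetric] X_def .
qed

text \<open>The factor |o| in the multiplicities is distributed over the |o| characters of the
  orbit, all of which have the same slopes.\<close>

lemma sum_slopes_orbit:
  "(\<Sum>x\<in>mult_orbit p (modulus \<gamma>) n. slopes p K \<gamma> x) = orbit_polygon \<gamma> (mult_orbit p (modulus \<gamma>) n)"
proof -
  have "slopes p K \<gamma> x = slopes p K \<gamma> n" if "x \<in> mult_orbit p (modulus \<gamma>) n" for x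
    by (simp only: slopes_eq_orbit mult_orbit_cong[OF that] rank_orbit[OF that])
  then have "(\<Sum>x\<in>mult_orbit p (modulus \<gamma>) n. slopes p K \<gamma> x)
      = (\<Sum>x\<in>mult_orbit p (modulus \<gamma>) n. slopes p K \<gamma> n)"
    by (rule sum.cong[OF refl])
  also have "\<dots> = repeat_mset (card (mult_orbit p (modulus \<gamma>) n)) (slopes p K \<gamma> n)"
    using finite_mult_orbit by (rule sum_constant_mset)
  finally show ?thesis by (simp only: orbit_polygon_eq)
qed

lemma slopes_0: "slopes p K \<gamma> 0 = {#}"
  by (simp add: slopes_def levels_def rank_def nat_signature_eq_0)

text \<open>The nonzero characters are grouped by orbit; the orbit of a nonzero character avoids 0
  because p is a unit. The character 0 can be included since it contributes no slopes.\<close>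

lemma mu_ordinary_eq: "mu_ordinary p \<gamma> = (\<Sum>n\<in>{0..<int (modulus \<gamma>)}. slopes p K \<gamma> n)"
proof -
  let ?m = "int (modulus \<gamma>)" and ?o = "mult_orbit p (modulus \<gamma>)"
  have fibre: "{x \<in> {1..<?m}. ?o x = ?o n} = ?o n" if n: "n \<in> {1..<?m}" for n
  proof (intro equalityI subsetI)
    fix x assume "x \<in> {x \<in> {1..<?m}. ?o x = ?o n}"
    then show "x \<in> ?o n" using self_in_mult_orbit[of x] by auto
  next
    fix x assume x: "x \<in> ?o n"
    have "\<not> ?m dvd int p ^ j * n" for j
    proof
      assume "?m dvd int p ^ j * n"
      then have "?m dvd n" using coprime_p by (simp add: coprime_dvd_mult_right_iff coprime_commute)
      then show False using n by (auto dest: zdvd_imp_le)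
    qed
    then have "x \<noteq> 0" using x by (auto simp: mult_orbit_def dvd_eq_mod_eq_0)
    moreover have "x \<in> {0..<?m}" using x mult_orbit_subset by blast
    ultimately show "x \<in> {x \<in> {1..<?m}. ?o x = ?o n}" using mult_orbit_cong[OF x] by auto
  qed
  have "mu_ordinary p \<gamma> = (\<Sum>\<oo>\<in>?o ` {1..<?m}. \<Sum>x\<in>{x \<in> {1..<?m}. ?o x = \<oo>}. slopes p K \<gamma> x)"
    unfolding mu_ordinary_def
  proof (rule sum.cong[OF refl])
    fix \<oo> assume "\<oo> \<in> ?o ` {1..<?m}"
    then obtain n where "n \<in> {1..<?m}" "\<oo> = ?o n" by auto
    then show "orbit_polygon \<gamma> \<oo> = (\<Sum>x\<in>{x \<in> {1..<?m}. ?o x = \<oo>}. slopes p K \<gamma> x)"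
      using fibre sum_slopes_orbit by simp
  qed
  also have "\<dots> = (\<Sum>x\<in>{1..<?m}. slopes p K \<gamma> x)"
    by (rule sum.image_gen[symmetric]) simp
  also have "\<dots> = (\<Sum>x\<in>insert 0 {1..<?m}. slopes p K \<gamma> x)"
    by (simp add: slopes_0)
  also have "insert 0 {1..<?m} = {0..<?m}" using m_pos by auto
  finally show ?thesis .
qed

end

section \<open>The number of characters with a node defect\<close>

lemma card_multiples:
  fixes c d :: nat
  assumes "c > 0"
  shows "card {n\<in>{0..<int (c * d)}. int c dvd n} = d"
proof -
  have "{n\<in>{0..<int (c * d)}. int c dvd n} = (\<lambda>k. int (c * k)) ` {..<d}"
  proof (intro equalityI subsetI)
    fix n assume n: "n \<in> {n\<in>{0..<int (c * d)}. int c dvd n}"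
    then obtain k where k: "n = int c * k" by auto
    with n assms have "k \<ge> 0" "k < int d" by (auto simp: zero_le_mult_iff)
    then show "n \<in> (\<lambda>k. int (c * k)) ` {..<d}"
      using k by (intro image_eqI[of _ _ "nat k"]) auto
  qed (use assms in auto)
  moreover have "inj_on (\<lambda>k. int (c * k)) {..<d}" using assms by (auto simp: inj_on_def)
  ultimately show ?thesis by (simp add: card_image)
qed

lemma dvd_mult_iff_div_gcd:
  fixes m :: nat and a n :: int
  assumes "m > 0"
  shows "int m dvd n * a \<longleftrightarrow> int m div gcd (int m) a dvd n"
proof -
  let ?g = "gcd (int m) a"
  have g: "?g > 0" using assms by simp
  have cop: "coprime (int m div ?g) (a div ?g)" using assms by (intro div_gcd_coprime) auto
  have "int m dvd n * a \<longleftrightarrow> (int m div ?g) * ?g dvd (n * (a div ?g)) * ?g"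
    by (simp only: mult.assoc dvd_div_mult_self gcd_dvd1 gcd_dvd2)
  also have "\<dots> \<longleftrightarrow> int m div ?g dvd n * (a div ?g)"
    using g by (intro dvd_times_right_cancel_iff) simp
  also have "\<dots> \<longleftrightarrow> int m div ?g dvd n" using cop by (rule coprime_dvd_mult_left_iff)
  finally show ?thesis .
qed

text \<open>If m_1 = x g and m_2 = y g with x, y coprime, the lcm is x y g, so d_1 = y and d_2 =
  x.\<close>

lemma coprime_rel_degree:
  assumes "modulus \<gamma>1 > 0" "modulus \<gamma>2 > 0"
  shows "coprime (rel_degree \<gamma>1 \<gamma>2 \<gamma>1) (rel_degree \<gamma>1 \<gamma>2 \<gamma>2)"
proof -
  let ?g = "gcd (modulus \<gamma>1) (modulus \<gamma>2)"
  have "?g \<noteq> 0" using assms by simp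
  then obtain x y where xy: "modulus \<gamma>1 = x * ?g" "modulus \<gamma>2 = y * ?g" "coprime x y"
    using gcd_coprime_exists by blast
  have lcm: "lcm (x * g) (y * g) = x * y * g" for g
    using lcm_coprime[OF xy(3)] by (simp add: lcm_mult_right lcm.commute)
  have "x * ?g > 0" "y * ?g > 0" using assms xy by auto
  then have "lcm (x * ?g) (y * ?g) div (x * ?g) = y" "lcm (x * ?g) (y * ?g) div (y * ?g) = x"
    unfolding lcm by (simp_all add: mult.commute mult.left_commute)
  then show ?thesis
    using xy by (simp add: rel_degree_def lcm_modulus_def coprime_commute)
qed

text \<open>Admissibility makes \<open>a\<^sub>1(N\<^sub>1)/m\<^sub>1\<close> and \<open>a\<^sub>2(1)/m\<^sub>2\<close> opposite in \<open>\<rat>/\<int>\<close>, hence of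
  the same order.\<close>

lemma admissible_gcd:
  assumes m1: "modulus \<gamma>1 > 0" and m2: "modulus \<gamma>2 > 0" and adm: "admissible \<gamma>1 \<gamma>2"
  shows "gcd (int (modulus \<gamma>1)) (entry \<gamma>1 (npoints \<gamma>1))
    = int (rel_degree \<gamma>1 \<gamma>2 \<gamma>2) * Gcd {int (modulus \<gamma>1), entry \<gamma>1 (npoints \<gamma>1), int (modulus \<gamma>2), entry \<gamma>2 1}"
proof -
  define a b where "a = entry \<gamma>1 (npoints \<gamma>1)" and "b = entry \<gamma>2 1"
  define D1 D2 where "D1 = int (rel_degree \<gamma>1 \<gamma>2 \<gamma>1)" and "D2 = int (rel_degree \<gamma>1 \<gamma>2 \<gamma>2)"
  define M1 M2 M where "M1 = int (modulus \<gamma>1)" and "M2 = int (modulus \<gamma>2)" and "M = int (lcm_modulus \<gamma>1 \<gamma>2)"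
  define R1 R2 where "R1 = gcd M1 a" and "R2 = gcd M2 b"
  have M: "M = D1 * M1" "M = D2 * M2"
    unfolding M_def M1_def M2_def D1_def D2_def
    by (simp_all only: of_nat_mult[symmetric] lcm_modulus_eq[symmetric])
  have "M > 0" using m1 m2 by (simp add: M_def lcm_modulus_def lcm_pos_nat)
  moreover have "D1 \<ge> 0" "D2 \<ge> 0" by (simp_all add: D1_def D2_def)
  ultimately have D: "D1 > 0" "D2 > 0" using M by (auto simp: less_le)
  have "M dvd D1 * a + D2 * b"
    using adm by (simp add: admissible_def M_def D1_def D2_def a_def b_def cong_0_iff)
  then have "[D1 * a = - (D2 * b)] (mod M)" by (simp add: cong_iff_dvd_diff)
  then have "gcd M (D1 * a) = gcd M (D2 * b)"
    using cong_gcd_eq[of "D1 * a" "- (D2 * b)" M] by (simp add: gcd.commute)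
  moreover have "gcd M (D1 * a) = D1 * R1"
    unfolding M(1) R1_def using D by (simp add: gcd_mult_left abs_mult)
  moreover have "gcd M (D2 * b) = D2 * R2"
    unfolding M(2) R2_def using D by (simp add: gcd_mult_left abs_mult)
  \<comment> \<open>Both sides are the gcd of m_3 with a scaled node entry. As \<open>D1\<close> and
    \<open>D2\<close> are coprime, \<open>R1 = D2 * s\<close> and \<open>R2 = D1 * s\<close> for
    some \<open>s\<close>, which is then the gcd of \<open>R1\<close> and \<open>R2\<close>.\<close>
  ultimately have eq: "D1 * R1 = D2 * R2" by simp
  have cop: "coprime D1 D2"
    using coprime_rel_degree[OF m1 m2] by (simp add: D1_def D2_def)
  have "D2 dvd D1 * R1" using eq by simp
  then have "D2 dvd R1" using cop by (simp add: coprime_dvd_mult_right_iff coprime_commute)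
  then obtain s where s: "R1 = D2 * s" by auto
  then have s2: "R2 = D1 * s" using eq D by simp
  have "R1 \<ge> 0" by (simp add: R1_def)
  then have "s \<ge> 0" using s D by (simp add: zero_le_mult_iff)
  have "Gcd {M1, a, M2, b} = gcd R1 R2" by (simp add: R1_def R2_def gcd.assoc)
  also have "\<dots> = gcd D2 D1 * s"
    unfolding s s2 gcd_mult_right using \<open>s \<ge> 0\<close> by (simp add: abs_mult gcd.commute)
  also have "\<dots> = s" using cop by (simp add: gcd.commute coprime_iff_gcd_eq_1)
  finally show ?thesis using s unfolding R1_def M1_def M2_def D2_def a_def b_def by simp
qed

text \<open>The condition m_1 | n a_1(N_1) holds for gcd(m_1, a_1(N_1)) d_1 = d_1 d_2 r_0
  characters. Among them are the d_1 multiples of m_1 and the d_2 multiples of m_2, which share only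
  0 and have to be removed.\<close>

lemma card_node_defect:
  assumes m1: "modulus \<gamma>1 > 0" and m2: "modulus \<gamma>2 > 0" and adm: "admissible \<gamma>1 \<gamma>2"
  defines "d1 \<equiv> rel_degree \<gamma>1 \<gamma>2 \<gamma>1" and "d2 \<equiv> rel_degree \<gamma>1 \<gamma>2 \<gamma>2"
    and "r0 \<equiv> Gcd {int (modulus \<gamma>1), entry \<gamma>1 (npoints \<gamma>1), int (modulus \<gamma>2), entry \<gamma>2 1}"
  shows "int (card {n\<in>{0..<int (lcm_modulus \<gamma>1 \<gamma>2)}. node_defect \<gamma>1 \<gamma>2 n})
    = int d1 * int d2 * r0 - int d1 - int d2 + 1"
proof -
  define a b where "a = entry \<gamma>1 (npoints \<gamma>1)" and "b = entry \<gamma>2 1"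
  define M1 M2 M where "M1 = modulus \<gamma>1" and "M2 = modulus \<gamma>2" and "M = lcm_modulus \<gamma>1 \<gamma>2"
  define R where "R = nat (gcd (int M1) a)"
  have M: "M = M1 * d1" "M = M2 * d2"
    using lcm_modulus_eq[of \<gamma>1 \<gamma>2] by (simp_all add: M_def M1_def M2_def d1_def d2_def mult.commute)
  have pos: "M > 0" "M1 > 0" "M2 > 0"
    using m1 m2 by (simp_all add: M_def M1_def M2_def lcm_modulus_def lcm_pos_nat)
  have R: "int R = gcd (int M1) a" "R > 0" using pos by (simp_all add: R_def)
  have R_eq: "int R = int d2 * r0"
    using admissible_gcd[OF m1 m2 adm] by (simp add: R M1_def a_def d2_def r0_def)
  have "R dvd M1" using R(1) by (metis gcd_dvd1 of_nat_dvd_iff)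
  then obtain c where c: "M1 = c * R" by (metis dvd_def mult.commute)
  have "c > 0" using c pos by (auto intro: Nat.gr0I)
  define I where "I = {0..<int M}"
  have "finite I" by (simp add: I_def)
  define S1 S2 T where "S1 = {n\<in>I. int M1 dvd n}" and "S2 = {n\<in>I. int M2 dvd n}"
    and "T = {n\<in>I. int M1 dvd n * a}"
  have fin: "finite S1" "finite S2" "finite T"
    using \<open>finite I\<close> by (simp_all add: S1_def S2_def T_def)
  have "int M1 div int R = int c" unfolding c using R(2) by simp
  then have dvdT: "int M1 dvd n * a \<longleftrightarrow> int c dvd n" for n
    using dvd_mult_iff_div_gcd[OF pos(2), of n a, folded R(1)] by simp
  have "T = {n\<in>{0..<int (c * (R * d1))}. int c dvd n}"
    unfolding T_def I_def dvdT unfolding M(1) c mult.assoc ..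
  then have cardT: "card T = R * d1" by (simp only: card_multiples[OF \<open>c > 0\<close>])
  have card1: "card S1 = d1" unfolding S1_def I_def M(1) by (rule card_multiples[OF pos(2)])
  have card2: "card S2 = d2" unfolding S2_def I_def M(2) by (rule card_multiples[OF pos(3)])
  have dvdM: "int M dvd n \<longleftrightarrow> int M1 dvd n \<and> int M2 dvd n" for n
    by (simp add: M_def M1_def M2_def lcm_modulus_def flip: lcm_int_int_eq)
  have "n = 0" if "0 \<le> n" "n < int M" "int M dvd n" for n
    using that zdvd_not_zless[of n "int M"] by linarith
  then have "S1 \<inter> S2 = {0}"
    unfolding S1_def S2_def I_def using pos dvdM by auto
  then have cardU: "card (S1 \<union> S2) + 1 = d1 + d2"
    using card_Un_Int[OF fin(1,2)] card1 card2 by simp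
  have sub: "S1 \<union> S2 \<subseteq> T"
  proof
    fix n assume n: "n \<in> S1 \<union> S2"
    have "int M1 dvd n * a"
    proof (cases "n \<in> S1")
      case False
      \<comment> \<open>For a multiple of m_2 the second summand of the admissibility relation,
        multiplied by n, is divisible by m_3; hence so is the first.\<close>
      then obtain k where k: "n = int M2 * k" using n by (auto simp: S2_def)
      have "int M dvd int d1 * a + int d2 * b"
        using adm by (simp add: admissible_def M_def d1_def d2_def a_def b_def cong_0_iff)
      then have "int M dvd n * (int d1 * a + int d2 * b)" by simp
      moreover have "n * (int d2 * b) = int M * (k * b)" by (simp add: k M(2))
      ultimately have "int M dvd n * (int d1 * a)"
        by (metis distrib_left dvd_add_left_iff dvd_triv_left)
      then have "int d1 * int M1 dvd int d1 * (n * a)" by (simp add: M(1) mult_ac)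
      moreover have "d1 > 0" using M(1) pos by (auto intro: Nat.gr0I)
      ultimately show ?thesis by simp
    qed (auto simp: S1_def)
    then show "n \<in> T" using n by (auto simp: T_def S1_def S2_def)
  qed
  have "{n\<in>I. node_defect \<gamma>1 \<gamma>2 n} = T - (S1 \<union> S2)"
    by (auto simp: node_defect_def T_def S1_def S2_def M1_def M2_def a_def)
  then have "card {n\<in>I. node_defect \<gamma>1 \<gamma>2 n} = card T - card (S1 \<union> S2)"
    using sub fin by (simp add: card_Diff_subset)
  moreover have "card (S1 \<union> S2) \<le> card T" using sub fin by (simp add: card_mono)
  ultimately have "int (card {n\<in>I. node_defect \<gamma>1 \<gamma>2 n}) = int R * int d1 - int d1 - int d2 + 1"
    using cardT cardU by (simp add: of_nat_diff)
  then show ?thesis by (simp add: I_def M_def R_eq mult_ac)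
qed

section \<open>Comparison of the polygons\<close>

text \<open>The projection from Z/m_3 to Z/m_i has d_i elements in each fibre, which is the origin
  of the exponents d_i.\<close>

lemma sum_mod_fibres:
  fixes g :: "int \<Rightarrow> 'a multiset"
  assumes "m > 0"
  shows "(\<Sum>n\<in>{0..<int (d * m)}. g (n mod int m)) = repeat_mset d (\<Sum>n\<in>{0..<int m}. g n)"
proof (induction d)
  case (Suc d)
  have split: "{0..<int (Suc d * m)} = {0..<int (d * m)} \<union> {int (d * m)..<int (d * m) + int m}"
    using of_nat_0_le_iff[of "d * m"] by (auto simp del: of_nat_mult simp: of_nat_add)
  have "n mod int m = n - int (d * m)" if "n \<in> {int (d * m)..<int (d * m) + int m}" for n
    using that mod_mult_self1[of "n - int (d * m)" "int d" "int m"] by simp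
  then have "(\<Sum>n\<in>{int (d * m)..<int (d * m) + int m}. g (n mod int m)) = (\<Sum>n\<in>{0..<int m}. g n)"
    by (intro sum.reindex_bij_witness[of _ "\<lambda>n. n + int (d * m)" "\<lambda>n. n - int (d * m)"]) auto
  then show ?case
    unfolding split using Suc by (subst sum.union_disjoint) (auto simp: add.commute)
qed simp

text \<open>An additive invariant of multisets of slopes, through which equality of polygons becomes
  an equality of numbers.\<close>

definition square_sum :: "rat multiset \<Rightarrow> rat" where
  "square_sum M = (\<Sum>x\<in>#M. x\<^sup>2)"

lemma square_sum_add: "square_sum (M + N) = square_sum M + square_sum N"
  by (simp add: square_sum_def)

lemma square_sum_sum: "finite A \<Longrightarrow> square_sum (\<Sum>x\<in>A. F x) = (\<Sum>x\<in>A. square_sum (F x))"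
  by (induction A rule: finite_induct) (simp_all add: square_sum_add, simp add: square_sum_def)

lemma square_sum_levels:
  assumes "finite J" "\<And>j. j \<in> J \<Longrightarrow> h j \<le> G"
  shows "square_sum (image_mset (\<lambda>c. of_nat c / of_nat K) (levels J h G))
    = of_nat (\<Sum>i\<in>J. \<Sum>j\<in>J. min (h i) (h j)) / (of_nat K)\<^sup>2"
proof -
  have "square_sum (image_mset (\<lambda>c. of_nat c / of_nat K) M) = of_nat (\<Sum>c\<in>#M. c\<^sup>2) / (of_nat K)\<^sup>2" for M
    by (induction M) (simp_all add: square_sum_def power_divide add_divide_distrib)
  then show ?thesis by (simp only: sum_squares_levels[OF assms])
qed

text \<open>The inequality \<open>min_add_le\<close> holds for every pair, so equal sums force
  equality for each pair, which \<open>min_add_eq_iff\<close> translates into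
  comonotonicity.\<close>

lemma comonotone_iff_sum_min:
  assumes "finite J"
  shows "comonotone_on J f g \<longleftrightarrow>
    (\<Sum>i\<in>J. \<Sum>j\<in>J. min (f i + g i) (f j + g j :: nat))
      = (\<Sum>i\<in>J. \<Sum>j\<in>J. min (f i) (f j)) + (\<Sum>i\<in>J. \<Sum>j\<in>J. min (g i) (g j))"
    (is "_ \<longleftrightarrow> ?l = ?r")
proof -
  have r: "?r = (\<Sum>(i,j)\<in>J \<times> J. min (f i) (f j) + min (g i) (g j))"
    by (simp add: sum.distrib sum.cartesian_product[symmetric])
  have l: "?l = (\<Sum>(i,j)\<in>J \<times> J. min (f i + g i) (f j + g j))"
    by (simp add: sum.cartesian_product[symmetric])
  show ?thesis
  proof
    assume "comonotone_on J f g"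
    then show "?l = ?r"
      unfolding l r comonotone_on_def by (intro sum.cong) (auto simp: min_add_eq_iff)
  next
    assume "?l = ?r"
    then have eq: "(\<Sum>(i,j)\<in>J \<times> J. min (f i) (f j) + min (g i) (g j)) = (\<Sum>(i,j)\<in>J \<times> J. min (f i + g i) (f j + g j))"
      unfolding l r by simp
    have "min (f i + g i) (f j + g j) = min (f i) (f j) + min (g i) (g j)" if "i \<in> J" "j \<in> J" for i j
      using sum_mono_inv[OF eq, of "(i, j)"] that assms min_add_le by fastforce
    then show "comonotone_on J f g" by (simp add: comonotone_on_def min_add_eq_iff)
  qed
qed

lemma sum_min_add_le:
  "(\<Sum>i\<in>J. \<Sum>j\<in>J. min (f i) (f j)) + (\<Sum>i\<in>J. \<Sum>j\<in>J. min (g i) (g j))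
    \<le> (\<Sum>i\<in>J. \<Sum>j\<in>J. min (f i + g i) (f j + g j :: nat))"
  unfolding sum.distrib[symmetric] by (intro sum_mono min_add_le)

text \<open>Every orbit is the image of the exponents below \<open>K\<close>, and reduction modulo
  m_3 does not affect signatures modulo m_1 or m_2.\<close>

lemma balanced_iff_comonotone:
  assumes K: "K > 0" and pos: "lcm_modulus \<gamma>1 \<gamma>2 > 0" and pK: "[int p ^ K = 1] (mod int (lcm_modulus \<gamma>1 \<gamma>2))"
    and i1: "integral_signature \<gamma>1 p K" and i2: "integral_signature \<gamma>2 p K"
  shows "balanced p \<gamma>1 \<gamma>2 \<longleftrightarrow> (\<forall>n\<in>{0..<int (lcm_modulus \<gamma>1 \<gamma>2)}.
    comonotone_on {..<K} (\<lambda>j. nat_signature \<gamma>1 (int p ^ j * n)) (\<lambda>j. nat_signature \<gamma>2 (int p ^ j * n)))"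
proof -
  interpret frobenius_period p "lcm_modulus \<gamma>1 \<gamma>2" K
    using K pos pK by unfold_locales
  have "pulled_signature \<gamma> (x mod int (lcm_modulus \<gamma>1 \<gamma>2)) = of_nat (nat_signature \<gamma> x)"
    if \<gamma>: "\<gamma> \<in> {\<gamma>1, \<gamma>2}" for \<gamma> x
  proof -
    have "int (modulus \<gamma>) dvd int (lcm_modulus \<gamma>1 \<gamma>2)" using \<gamma> by (auto simp: lcm_modulus_def)
    then have "[x mod int (lcm_modulus \<gamma>1 \<gamma>2) = x] (mod int (modulus \<gamma>))"
      by (simp add: cong_def mod_mod_cancel)
    moreover have "signature \<gamma> x = of_nat (nat_signature \<gamma> x)"
      using \<gamma> i1 i2 by (auto intro: integral_signature.signature_eq)
    ultimately show ?thesis by (simp add: pulled_signature_eq signature_cong)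
  qed
  then show ?thesis
    by (simp add: balanced_def mult_orbit_eq comonotone_on_def)
qed

text \<open>The defect is constant along the powers of p and even in n, so it raises the signature
  by 1 on the whole orbit and g by 2. By \<open>levels_shift\<close> this adds the parts 0 and
  \<open>K\<close>, that is, the slopes 0 and 1.\<close>

lemma slopes_clutch:
  assumes m1: "modulus \<gamma>1 > 0" and m2: "modulus \<gamma>2 > 0" and N1: "npoints \<gamma>1 \<ge> 2" and N2: "npoints \<gamma>2 \<ge> 2"
    and adm: "admissible \<gamma>1 \<gamma>2"
    and i1: "integral_signature \<gamma>1 p K" and i2: "integral_signature \<gamma>2 p K"
  shows "slopes p K (clutch \<gamma>1 \<gamma>2) n =
    image_mset (\<lambda>c. of_nat c / of_nat K) (levels {..<K}
      (\<lambda>j. nat_signature \<gamma>1 (int p ^ j * n) + nat_signature \<gamma>2 (int p ^ j * n)) (rank \<gamma>1 n + rank \<gamma>2 n))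
    + repeat_mset (of_bool (node_defect \<gamma>1 \<gamma>2 n)) ord_polygon"
proof -
  interpret S1: integral_signature \<gamma>1 p K by fact
  interpret S2: integral_signature \<gamma>2 p K by fact
  have sig: "nat_signature (clutch \<gamma>1 \<gamma>2) x
      = nat_signature \<gamma>1 x + nat_signature \<gamma>2 x + of_bool (node_defect \<gamma>1 \<gamma>2 x)" for x
  proof -
    have "signature (clutch \<gamma>1 \<gamma>2) x
        = of_nat (nat_signature \<gamma>1 x + nat_signature \<gamma>2 x + of_bool (node_defect \<gamma>1 \<gamma>2 x))"
      unfolding signature_clutch[OF m1 m2 N1 N2 adm] S1.signature_eq S2.signature_eq by simp
    then show ?thesis unfolding nat_signature_def[of "clutch \<gamma>1 \<gamma>2"] by (simp only: floor_of_nat nat_int)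
  qed
  have rank: "rank (clutch \<gamma>1 \<gamma>2) n = rank \<gamma>1 n + rank \<gamma>2 n + 2 * of_bool (node_defect \<gamma>1 \<gamma>2 n)"
    by (simp add: rank_def sig node_defect_uminus)
  have defect: "node_defect \<gamma>1 \<gamma>2 (int p ^ j * n) \<longleftrightarrow> node_defect \<gamma>1 \<gamma>2 n" for j
    using S1.coprime_p S2.coprime_p by (intro node_defect_mult_coprime) auto
  have le: "nat_signature \<gamma>1 (int p ^ j * n) + nat_signature \<gamma>2 (int p ^ j * n) \<le> rank \<gamma>1 n + rank \<gamma>2 n" for j
    by (intro add_mono S1.nat_signature_le_rank S2.nat_signature_le_rank)
  show ?thesis
  proof (cases "node_defect \<gamma>1 \<gamma>2 n")
    case True
    then show ?thesis
      using levels_shift[of "{..<K}" "\<lambda>j. nat_signature \<gamma>1 (int p ^ j * n) + nat_signature \<gamma>2 (int p ^ j * n)", OF _ le]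
        S1.K_pos
      by (simp add: slopes_def sig rank defect ord_polygon_def)
  next
    case False
    then show ?thesis by (simp add: slopes_def sig rank defect)
  qed
qed

text \<open>Comonotonicity gives equality for each n separately. Conversely only the totals over
  \<open>I\<close> are known to agree, but square sums turn this into equality of totals of numbers
  that satisfy an inequality for each n, so equality holds for each n.\<close>

lemma sum_levels_eq_iff_comonotone:
  fixes I :: "'a set" and h1 h2 :: "'a \<Rightarrow> nat \<Rightarrow> nat"
  assumes "finite I" and K: "K > 0"
    and le1: "\<And>n j. h1 n j \<le> G1 n" and le2: "\<And>n j. h2 n j \<le> G2 n"
  defines "P \<equiv> \<lambda>h G. image_mset (\<lambda>c. of_nat c / of_nat K :: rat) (levels {..<K} h G)"
  shows "(\<Sum>n\<in>I. P (\<lambda>j. h1 n j + h2 n j) (G1 n + G2 n)) = (\<Sum>n\<in>I. P (h1 n) (G1 n)) + (\<Sum>n\<in>I. P (h2 n) (G2 n))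
    \<longleftrightarrow> (\<forall>n\<in>I. comonotone_on {..<K} (h1 n) (h2 n))"
    (is "?l = ?r \<longleftrightarrow> _")
proof
  assume "\<forall>n\<in>I. comonotone_on {..<K} (h1 n) (h2 n)"
  then have "P (\<lambda>j. h1 n j + h2 n j) (G1 n + G2 n) = P (h1 n) (G1 n) + P (h2 n) (G2 n)" if "n \<in> I" for n
    using that levels_add_comonotone[of "{..<K}" "h1 n" "G1 n" "h2 n" "G2 n"] le1 le2 by (simp add: P_def)
  then show "?l = ?r" by (simp add: sum.distrib)
next
  assume eq: "?l = ?r"
  define m where "m h = (\<Sum>i<K. \<Sum>j<K. min (h i) (h j))" for h :: "nat \<Rightarrow> nat"
  have sq: "square_sum (P h G) = of_nat (m h) / (of_nat K)\<^sup>2" if "\<And>j. h j \<le> G" for h G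
    unfolding P_def m_def using that by (intro square_sum_levels) auto
  have "square_sum ?l = of_nat (\<Sum>n\<in>I. m (\<lambda>j. h1 n j + h2 n j)) / (of_nat K)\<^sup>2"
    using \<open>finite I\<close> le1 le2 by (simp add: square_sum_sum sq add_mono sum_divide_distrib)
  moreover have "square_sum ?r = of_nat (\<Sum>n\<in>I. m (h1 n) + m (h2 n)) / (of_nat K)\<^sup>2"
    using \<open>finite I\<close> le1 le2
    by (simp add: square_sum_sum square_sum_add sq sum_divide_distrib sum.distrib add_divide_distrib)
  ultimately have "(of_nat (\<Sum>n\<in>I. m (h1 n) + m (h2 n)) :: rat) = of_nat (\<Sum>n\<in>I. m (\<lambda>j. h1 n j + h2 n j))"
    using eq K by (simp del: of_nat_sum)
  then have m_eq: "(\<Sum>n\<in>I. m (h1 n) + m (h2 n)) = (\<Sum>n\<in>I. m (\<lambda>j. h1 n j + h2 n j))"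
    by (simp only: of_nat_eq_iff)
  show "\<forall>n\<in>I. comonotone_on {..<K} (h1 n) (h2 n)"
  proof
    fix n assume "n \<in> I"
    then have "m (h1 n) + m (h2 n) = m (\<lambda>j. h1 n j + h2 n j)"
      using sum_mono_inv[OF m_eq] sum_min_add_le \<open>finite I\<close> unfolding m_def by blast
    then show "comonotone_on {..<K} (h1 n) (h2 n)"
      by (simp add: comonotone_iff_sum_min m_def)
  qed
qed

theorem proposition4p4:
  fixes \<gamma>1 \<gamma>2 \<gamma>3 :: monodromy_datum
    and p m3 d1 d2 :: nat and r0 \<epsilon> :: int and u1 u2 u3 :: "rat multiset"
  assumes "generalized_monodromy_datum \<gamma>1" and "generalized_monodromy_datum \<gamma>2"
    and "admissible \<gamma>1 \<gamma>2"
    and "m3 = lcm (modulus \<gamma>1) (modulus \<gamma>2)"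
    and "d1 = m3 div modulus \<gamma>1" and "d2 = m3 div modulus \<gamma>2"
    and "prime p" and "\<not> p dvd m3"
    and "\<gamma>3 = clutch \<gamma>1 \<gamma>2"
    and "u1 = mu_ordinary p \<gamma>1" and "u2 = mu_ordinary p \<gamma>2" and "u3 = mu_ordinary p \<gamma>3"
    and "r0 = Gcd {int (modulus \<gamma>1), entry \<gamma>1 (npoints \<gamma>1), int (modulus \<gamma>2), entry \<gamma>2 1}"
    and "\<epsilon> = int d1 * int d2 * r0 - int d1 - int d2 + 1"
  shows "u3 = repeat_mset d1 u1 + repeat_mset d2 u2 + repeat_mset (nat \<epsilon>) ord_polygon
         \<longleftrightarrow> balanced p \<gamma>1 \<gamma>2"
proof -
  have m1: "modulus \<gamma>1 > 0" and m2: "modulus \<gamma>2 > 0" and N1: "npoints \<gamma>1 \<ge> 2" and N2: "npoints \<gamma>2 \<ge> 2"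
    using assms(1,2) by (auto simp: generalized_monodromy_datum_def)
  have m3: "m3 = lcm_modulus \<gamma>1 \<gamma>2" "modulus \<gamma>3 = m3"
    using assms(4,9) by (simp_all add: lcm_modulus_def clutch_def)
  have "m3 > 0" using m1 m2 assms(4) by (simp add: lcm_pos_nat)
  have d: "d1 = rel_degree \<gamma>1 \<gamma>2 \<gamma>1" "d2 = rel_degree \<gamma>1 \<gamma>2 \<gamma>2"
    using assms(5,6) m3(1) by (simp_all add: rel_degree_def)
  have m3d: "m3 = d1 * modulus \<gamma>1" "m3 = d2 * modulus \<gamma>2"
    unfolding d m3(1) by (rule lcm_modulus_eq)+
  \<comment> \<open>By Euler's theorem this is a period of p modulo m_3, hence modulo all three
    moduli.\<close>
  define K where "K = totient m3"
  have "K > 0" using \<open>m3 > 0\<close> by (simp add: K_def)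
  have "coprime p m3" using assms(7,8) by (simp add: prime_imp_coprime)
  then have "[p ^ K = 1] (mod m3)" unfolding K_def by (rule euler_theorem)
  then have pK: "[int p ^ K = 1] (mod int m3)"
    using cong_int_iff[of "p ^ K" 1 m3] by simp
  have int_sig: "integral_signature \<gamma> p K" if "modulus \<gamma> dvd m3" "modulus \<gamma> > 0" "\<And>n. signature \<gamma> n \<in> \<nat>" for \<gamma>
    using that \<open>K > 0\<close> pK by unfold_locales (auto intro: cong_dvd_modulus)
  have i1: "integral_signature \<gamma>1 p K" and i2: "integral_signature \<gamma>2 p K"
    using m1 m2 assms(1,2) by (auto simp: assms(4) intro!: int_sig signature_in_Nats)
  interpret S1: integral_signature \<gamma>1 p K by (rule i1)
  interpret S2: integral_signature \<gamma>2 p K by (rule i2)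
  have "signature \<gamma>3 n \<in> \<nat>" for n
    unfolding assms(9) signature_clutch[OF m1 m2 N1 N2 assms(3)]
    using S1.signature_Nats S2.signature_Nats by simp
  then interpret S3: integral_signature \<gamma>3 p K
    using m3 \<open>m3 > 0\<close> by (intro int_sig) auto
  define I where "I = {0..<int m3}"
  define P :: "(nat \<Rightarrow> nat) \<Rightarrow> nat \<Rightarrow> rat multiset"
    where "P = (\<lambda>h G. image_mset (\<lambda>c. of_nat c / of_nat K) (levels {..<K} h G))"
  define h where "h = (\<lambda>\<gamma> n j. nat_signature \<gamma> (int p ^ j * n))"
  have slopes: "slopes p K \<gamma> n = P (h \<gamma> n) (rank \<gamma> n)" for \<gamma> n
    by (simp add: slopes_def P_def h_def)
  have pull: "repeat_mset d (mu_ordinary p \<gamma>) = (\<Sum>n\<in>I. P (h \<gamma> n) (rank \<gamma> n))"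
    if "integral_signature \<gamma> p K" "m3 = d * modulus \<gamma>" "modulus \<gamma> > 0" for \<gamma> d
  proof -
    have mod: "slopes p K \<gamma> (n mod int (modulus \<gamma>)) = slopes p K \<gamma> n" for n
      by (rule slopes_cong) (simp add: cong_def)
    show ?thesis
      using sum_mod_fibres[OF that(3), of "slopes p K \<gamma>" d]
      by (simp only: mod integral_signature.mu_ordinary_eq[OF that(1)] I_def that(2) slopes[symmetric])
  qed
  have "(\<Sum>n\<in>I. repeat_mset (of_bool (node_defect \<gamma>1 \<gamma>2 n)) ord_polygon) = repeat_mset (nat \<epsilon>) ord_polygon"
  proof -
    \<comment> \<open>Being a cardinality, \<open>\<epsilon>\<close> is nonnegative, so
      \<open>nat \<epsilon>\<close> is its true value.\<close>
    have "int (card {n\<in>I. node_defect \<gamma>1 \<gamma>2 n}) = \<epsilon>"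
      using card_node_defect[OF m1 m2 assms(3)] by (simp add: assms(13,14) d I_def m3(1))
    then have "nat \<epsilon> = (\<Sum>n\<in>I. of_bool (node_defect \<gamma>1 \<gamma>2 n))"
      by (auto simp: I_def Int_def)
    moreover have "(\<Sum>n\<in>A. repeat_mset (f n) M) = repeat_mset (sum f A) M" if "finite A"
      for A :: "int set" and f and M :: "rat multiset"
      using that by (induction A rule: finite_induct) (simp_all add: repeat_mset_distrib)
    ultimately show ?thesis by (simp add: I_def)
  qed
  moreover have "u3 = (\<Sum>n\<in>I. slopes p K \<gamma>3 n)"
    unfolding assms(12) I_def m3(2)[symmetric] by (rule S3.mu_ordinary_eq)
  ultimately have u3: "u3 = (\<Sum>n\<in>I. P (\<lambda>j. h \<gamma>1 n j + h \<gamma>2 n j) (rank \<gamma>1 n + rank \<gamma>2 n))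
      + repeat_mset (nat \<epsilon>) ord_polygon"
    by (simp add: assms(9) slopes_clutch[OF m1 m2 N1 N2 assms(3) i1 i2] sum.distrib P_def h_def)
  \<comment> \<open>All polygons are now sums over the characters modulo m_3, and the ord terms on
    both sides cancel.\<close>
  have "u3 = repeat_mset d1 u1 + repeat_mset d2 u2 + repeat_mset (nat \<epsilon>) ord_polygon \<longleftrightarrow>
      (\<Sum>n\<in>I. P (\<lambda>j. h \<gamma>1 n j + h \<gamma>2 n j) (rank \<gamma>1 n + rank \<gamma>2 n))
        = (\<Sum>n\<in>I. P (h \<gamma>1 n) (rank \<gamma>1 n)) + (\<Sum>n\<in>I. P (h \<gamma>2 n) (rank \<gamma>2 n))"
    unfolding u3 assms(10,11) pull[OF i1 m3d(1) m1] pull[OF i2 m3d(2) m2] by (rule add_right_cancel)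
  also have "\<dots> \<longleftrightarrow> (\<forall>n\<in>I. comonotone_on {..<K} (h \<gamma>1 n) (h \<gamma>2 n))"
    unfolding P_def h_def
    by (rule sum_levels_eq_iff_comonotone)
       (simp_all add: I_def \<open>K > 0\<close> S1.nat_signature_le_rank S2.nat_signature_le_rank)
  also have "\<dots> \<longleftrightarrow> balanced p \<gamma>1 \<gamma>2"
    using balanced_iff_comonotone[OF \<open>K > 0\<close> _ _ i1 i2] \<open>m3 > 0\<close> pK
    by (simp add: I_def h_def m3(1))
  finally show ?thesis .
qed

end
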